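(* Suppose $U:\mathbb R\to[0,1]$ is measurable with $\mathbb E_\xi[\xi U(\xi)]\ne0$, let $\eta>0$, let $M\le N$, and let $\boldsymbol G$ be an $M\times N$ matrix with i.i.d. standard Gaussian entries. Then $$\mathbb P\Big(\big|\log\boldsymbol Z(\eta)-\mathbb E\log\boldsymbol Z(\eta)\big|\ge Nx\Big)\le32N\exp\bigg\{-\frac{Nx^2}{32\,C_2\,C_1(U;\eta)^2}\bigg\}$$ for all $0\le x\le5\,(C_2)^{1/2}\,C_1(U;\eta)$.
   Context: $\xi$ is a standard Gaussian random variable. $U_\eta(x)=\mathbb E_\xi U(x+\eta\xi)$ and, with $\mathbf g^1,\dots,\mathbf g^M$ the rows of $\boldsymbol G$, $\boldsymbol Z(\eta)=\sum_{J\in\{-1,+1\}^N}\prod_{a\le M}U_\eta\big((\mathbf g^a,J)/N^{1/2}\big)$. Constants: $C_2\ge1$ is a fixed absolute constant such that for all $M\le N$, an $M\times N$ matrix $\boldsymbol G$ with i.i.d. standard Gaussian entries has maximum singular value $s_{\max}(\boldsymbol G)$ satisfying $\mathbb P(s_{\max}(\boldsymbol G)\ge(C_2N)^{1/2}+t)\le2\exp(-t^2/C_2)$ for all $t\ge0$. $C_1(U;\eta)$ is a finite positive constant depending only on $U$ and $\eta$ such that $\big|\frac{d}{dx}\log U_\eta(x)\big|\le C_1(U;\eta)(1+|x|)$ for all $x\in\mathbb R$. *)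

theory Defs
  imports "HOL-Probability.Probability" "Jordan_Normal_Form.Char_Poly"
begin

definition smoothed :: "(real \<Rightarrow> real) \<Rightarrow> real \<Rightarrow> real \<Rightarrow> real" where
  "smoothed U \<eta> x = (LINT \<xi>|std_normal_distribution. U (x + \<eta> * \<xi>))"

text \<open>Matrices are functions on index pairs, of which only the entries in
  \<open>{..<m} \<times> {..<n}\<close> matter; row \<open>a\<close> of \<open>G\<close> is \<open>\<lambda>i. G (a, i)\<close>.\<close>

definition partition_fun ::
    "(real \<Rightarrow> real) \<Rightarrow> real \<Rightarrow> nat \<Rightarrow> nat \<Rightarrow> (nat \<times> nat \<Rightarrow> real) \<Rightarrow> real" where
  "partition_fun U \<eta> m n G =
     (\<Sum>J \<in> {..<n} \<rightarrow>\<^sub>E {-1, 1}. \<Prod>a<m. smoothed U \<eta> ((\<Sum>i<n. G (a, i) * J i) / sqrt n))"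

definition gaussian_matrix :: "nat \<Rightarrow> nat \<Rightarrow> (nat \<times> nat \<Rightarrow> real) measure" where
  "gaussian_matrix m n = PiM ({..<m} \<times> {..<n}) (\<lambda>_. std_normal_distribution)"

text \<open>Singular values are the square roots of the eigenvalues of \<open>A\<^sup>T A\<close>. If \<open>A\<close> has
  fewer rows than columns, this adds the value 0 to those obtained from \<open>A A\<^sup>T\<close>, which does
  not affect the maximum. Meaningful for at least one column only.\<close>

definition singular_values :: "real mat \<Rightarrow> real set" where
  "singular_values A = {s. 0 \<le> s \<and> eigenvalue (transpose_mat A * A) (s\<^sup>2)}"

definition s_max :: "real mat \<Rightarrow> real" where
  "s_max A = Max (singular_values A)"

end

theory Submission
  imports Defs
begin

text \<open>Write \<open>F\<close> for the logarithm of the partition function, as a function of the Gaussian matrix. Its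
gradient is unbounded, so the concentration inequality for Lipschitz functions does not apply.
Instead the interpolation argument of Maurey and Pisier is used: if \<open>X\<close>, \<open>Y\<close> are independent standard
Gaussian vectors, the rotation \<open>(X, Y) \<mapsto> (cos \<theta> X + sin \<theta> Y, cos \<theta> Y - sin \<theta> X)\<close> preserves their joint
law, and writing \<open>F X - F Y\<close> as an integral of the derivative of \<open>F\<close> along this rotation gives,
by Jensen's inequality, \<open>E exp (l (F - E F)) \<le> E exp (l\<^sup>2 \<pi>\<^sup>2 / 8 |\<nabla>F|\<^sup>2)\<close>
(\<open>maurey_pisier\<close>). A random gradient is thus harmless if its square has exponential moments.

The partial derivatives of \<open>F\<close> are Gibbs averages, and the growth condition on the derivative of
\<open>log U\<^sub>\<eta>\<close> bounds \<open>|\<nabla>F|\<^sup>2\<close> by \<open>2 C\<^sub>1\<^sup>2\<close> times \<open>M\<close> plus the Gibbs average of \<open>|G J|\<^sup>2 / N\<close>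
(\<open>gradient_bound\<close>). For a fixed spin vector \<open>J\<close> the vector \<open>G J / \<surd>N\<close> is standard Gaussian, so that
\<open>E exp (3/8 |G J|\<^sup>2 / N) = 2\<^sup>M\<close>, and a union bound over the \<open>2\<^sup>N\<close> spin vectors controls all
of them at once at the price of a factor \<open>2\<^sup>N\<close> (\<open>exp_gradient_bound\<close>). Altogether
\<open>E exp (l (F - E F)) \<le> exp (c N (1 + 16/3 log 2))\<close> with \<open>c = l\<^sup>2 \<pi>\<^sup>2 C\<^sub>1\<^sup>2 / 4\<close>, as long as
\<open>c \<le> 3/8\<close> (\<open>logZ_mgf\<close>).

The tail bound follows from the exponential Markov inequality with \<open>l = x / (4 \<pi> C\<^sub>1\<^sup>2 C\<^sub>2)\<close>; the
restriction on \<open>x\<close> is what keeps \<open>c \<le> 3/8\<close>. To obtain the constant 32 in the exponent one needs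
\<open>C\<^sub>2\<close> to be not too close to 1. The tail bound for the largest singular value provides this already
for \<open>1 \<times> 1\<close> matrices: there it is a bound for the tail of one Gaussian variable, which decays
like \<open>exp (- t\<^sup>2 / 2)\<close> and so excludes \<open>C\<^sub>2 < 9/5\<close> (\<open>edge_constant_lower\<close>).\<close>

section \<open>Gaussian exponential moments\<close>

abbreviation gauss where "gauss \<equiv> std_normal_distribution"

abbreviation gauss_vec :: "'i set \<Rightarrow> ('i \<Rightarrow> real) measure" where
  "gauss_vec I \<equiv> PiM I (\<lambda>_. gauss)"

lemma prob_space_gauss: "prob_space gauss"
  by (rule prob_space_normal_density) simp

text \<open>Jensen's inequality for the exponential, with a nonnegative integral on the right so that no
integrability of \<open>exp \<circ> h\<close> has to be known: it is used before exponential moments are known to be finite.\<close>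

lemma (in prob_space) exp_expectation_le:
  fixes h :: "'a \<Rightarrow> real"
  assumes [simp]: "integrable M h"
  shows "ennreal (exp (expectation h)) \<le> (\<integral>\<^sup>+x. ennreal (exp (h x)) \<partial>M)"
proof (cases "(\<integral>\<^sup>+x. ennreal (exp (h x)) \<partial>M) = \<infinity>")
  case False
  then have e [simp]: "integrable M (\<lambda>x. exp (h x))"
    using borel_measurable_integrable[OF assms]
    by (intro integrableI_nonneg) (auto simp: top.not_eq_extremum)
  define a where "a = expectation h"
  have "expectation (\<lambda>x. exp a * (1 + (h x - a))) \<le> expectation (\<lambda>x. exp (h x))"
  proof (rule integral_mono)
    fix x
    have "exp a * (1 + (h x - a)) \<le> exp a * exp (h x - a)"
      using exp_ge_add_one_self[of "h x - a"] by (intro mult_left_mono) auto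
    then show "exp a * (1 + (h x - a)) \<le> exp (h x)"
      by (simp add: exp_diff)
  qed auto
  also have "expectation (\<lambda>x. exp a * (1 + (h x - a))) = exp a"
    by (simp add: prob_space a_def)
  finally show ?thesis
    by (subst nn_integral_eq_integral) (auto simp: a_def)
qed simp

lemma gauss_mgf: "(\<integral>\<^sup>+z. ennreal (exp (d * z)) \<partial>gauss) = ennreal (exp (d\<^sup>2 / 2))"
proof -
  have "(\<integral>\<^sup>+z. ennreal (exp (d * z)) \<partial>gauss)
      = (\<integral>\<^sup>+z. ennreal (exp (d\<^sup>2 / 2)) * ennreal (normal_density d 1 z) \<partial>lborel)"
    by (subst nn_integral_density)
       (auto intro!: nn_integral_cong simp: normal_density_def ennreal_mult'[symmetric]
          exp_add[symmetric] power2_eq_square field_simps)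
  also have "\<dots> = ennreal (exp (d\<^sup>2 / 2)) * (\<integral>\<^sup>+z. ennreal (normal_density d 1 z) \<partial>lborel)"
    by (rule nn_integral_cmult) auto
  also have "(\<integral>\<^sup>+z. ennreal (normal_density d 1 z) \<partial>lborel) = 1"
    by (subst nn_integral_eq_integral) auto
  finally show ?thesis by simp
qed

text \<open>In general \<open>E exp (\<kappa> z\<^sup>2) = (1 - 2 \<kappa>) powr (-1/2)\<close>; the value \<open>\<kappa> = 3/8\<close> makes this the integer 2, and
is close to the choice that optimises the final constant.\<close>

lemma gauss_exp_square: "(\<integral>\<^sup>+z. ennreal (exp (3/8 * z\<^sup>2)) \<partial>gauss) = 2"
proof -
  have "(\<integral>\<^sup>+z. ennreal (exp (3/8 * z\<^sup>2)) \<partial>gauss)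
      = (\<integral>\<^sup>+z. 2 * ennreal (normal_density 0 2 z) \<partial>lborel)"
  proof (subst nn_integral_density)
    have s: "sqrt (8 * pi) = 2 * sqrt (2 * pi)"
      using real_sqrt_mult[of 4 "2 * pi"] by simp
    have "std_normal_density z * exp (3/8 * z\<^sup>2) = 2 * normal_density 0 2 z" for z
      using s by (simp add: normal_density_def exp_add[symmetric] real_sqrt_mult)
    then show "(\<integral>\<^sup>+ z. ennreal (std_normal_density z) * ennreal (exp (3 / 8 * z\<^sup>2)) \<partial>lborel)
       = (\<integral>\<^sup>+z. 2 * ennreal (normal_density 0 2 z) \<partial>lborel)"
      by (intro nn_integral_cong) (simp add: ennreal_mult'[symmetric] flip: ennreal_numeral)
  qed auto
  also have "\<dots> = 2 * (\<integral>\<^sup>+z. ennreal (normal_density 0 2 z) \<partial>lborel)"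
    by (rule nn_integral_cmult) auto
  also have "(\<integral>\<^sup>+z. ennreal (normal_density 0 2 z) \<partial>lborel) = 1"
    by (subst nn_integral_eq_integral) auto
  finally show ?thesis by simp
qed

lemma gauss_vec_product:
  assumes "finite I" "\<And>i. i \<in> I \<Longrightarrow> f i \<in> borel_measurable borel"
  shows "(\<integral>\<^sup>+x. (\<Prod>i\<in>I. f i (x i)) \<partial>gauss_vec I) = (\<Prod>i\<in>I. \<integral>\<^sup>+z. f i z \<partial>gauss)"
proof -
  interpret product_sigma_finite "\<lambda>_. gauss"
    unfolding product_sigma_finite_def
    using prob_space_gauss prob_space_imp_sigma_finite by blast
  show ?thesis using assms by (intro product_nn_integral_prod) auto
qed

lemma gauss_vec_mgf:
  assumes "finite I"
  shows "(\<integral>\<^sup>+x. ennreal (exp (\<Sum>i\<in>I. d i * x i)) \<partial>gauss_vec I) = ennreal (exp ((\<Sum>i\<in>I. (d i)\<^sup>2) / 2))"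
proof -
  have "(\<integral>\<^sup>+x. ennreal (exp (\<Sum>i\<in>I. d i * x i)) \<partial>gauss_vec I)
      = (\<integral>\<^sup>+x. (\<Prod>i\<in>I. ennreal (exp (d i * x i))) \<partial>gauss_vec I)"
    using assms by (intro nn_integral_cong) (simp add: exp_sum prod_ennreal)
  also have "\<dots> = (\<Prod>i\<in>I. \<integral>\<^sup>+z. ennreal (exp (d i * z)) \<partial>gauss)"
    using assms by (intro gauss_vec_product) auto
  also have "\<dots> = ennreal (exp ((\<Sum>i\<in>I. (d i)\<^sup>2) / 2))"
    using assms by (simp add: gauss_mgf exp_sum prod_ennreal sum_divide_distrib)
  finally show ?thesis .
qed

lemma prob_space_gauss_vec: "prob_space (gauss_vec I)"
  by (intro prob_space_PiM prob_space_gauss)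

text \<open>The reason is that the normalised overlaps of the rows with \<open>J\<close> are independent standard Gaussians.
Their joint law need not be computed: the square in the exponent is linearised by an auxiliary
Gaussian vector \<open>z\<close>, as \<open>exp (d\<^sup>2 / 2) = E exp (d z)\<close>, and after exchanging the integrals
only the moment generating function of the matrix entries is needed.\<close>

lemma gauss_rows_exp_square:
  fixes J :: "nat \<Rightarrow> real"
  assumes J: "\<And>i. i < n \<Longrightarrow> (J i)\<^sup>2 = 1" and n: "0 < n"
  shows "(\<integral>\<^sup>+x. ennreal (exp (3/8 * (\<Sum>a<m. ((\<Sum>i<n. x (a, i) * J i) / sqrt n)\<^sup>2)))
            \<partial>gauss_vec ({..<m} \<times> {..<n})) = 2 ^ m"
proof -
  let ?I = "{..<m} \<times> {..<n}" and ?c = "sqrt (3/4 :: real)"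
  let ?\<mu> = "gauss_vec ?I" and ?\<nu> = "gauss_vec {..<m}"
  let ?\<Delta> = "\<lambda>x a. (\<Sum>i<n. x (a, i) * J i) / sqrt n"
  interpret m: prob_space ?\<mu> by (rule prob_space_gauss_vec)
  interpret n: prob_space ?\<nu> by (rule prob_space_gauss_vec)
  interpret pair_sigma_finite ?\<nu> ?\<mu> ..
  have "ennreal (exp (3/8 * (\<Sum>a<m. (?\<Delta> x a)\<^sup>2)))
      = (\<integral>\<^sup>+z. ennreal (exp (\<Sum>a<m. (?c * ?\<Delta> x a) * z a)) \<partial>?\<nu>)" for x :: "nat \<times> nat \<Rightarrow> real"
  proof -
    have "(\<Sum>a<m. (?c * ?\<Delta> x a)\<^sup>2) = 3/4 * (\<Sum>a<m. (?\<Delta> x a)\<^sup>2)"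
      unfolding power_mult_distrib sum_distrib_left by simp
    then show ?thesis by (subst gauss_vec_mgf) simp_all
  qed
  then have "(\<integral>\<^sup>+x. ennreal (exp (3/8 * (\<Sum>a<m. (?\<Delta> x a)\<^sup>2))) \<partial>?\<mu>)
      = (\<integral>\<^sup>+x. \<integral>\<^sup>+z. ennreal (exp (\<Sum>a<m. (?c * ?\<Delta> x a) * z a)) \<partial>?\<nu> \<partial>?\<mu>)"
    by simp
  also have "\<dots> = (\<integral>\<^sup>+z. \<integral>\<^sup>+x. ennreal (exp (\<Sum>a<m. (?c * ?\<Delta> x a) * z a)) \<partial>?\<mu> \<partial>?\<nu>)"
    by (rule Fubini') measurable
  also have "\<dots> = (\<integral>\<^sup>+z. \<integral>\<^sup>+x. ennreal (exp (\<Sum>k\<in>?I. (?c * z (fst k) * J (snd k) / sqrt n) * x k)) \<partial>?\<mu> \<partial>?\<nu>)"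
    by (simp add: sum.cartesian_product' sum_distrib_left sum_distrib_right sum_divide_distrib mult_ac)
  also have "\<dots> = (\<integral>\<^sup>+z. ennreal (exp (3/8 * (\<Sum>a<m. (z a)\<^sup>2))) \<partial>?\<nu>)"
  proof (rule nn_integral_cong)
    fix z :: "nat \<Rightarrow> real"
    have "(\<Sum>k\<in>?I. (?c * z (fst k) * J (snd k) / sqrt n)\<^sup>2) = (\<Sum>a<m. \<Sum>i<n. 3/4 * (z a)\<^sup>2 / n)"
      unfolding sum.cartesian_product' using J
      by (intro sum.cong refl) (simp add: power_mult_distrib power_divide)
    then have s: "(\<Sum>k\<in>?I. (?c * z (fst k) * J (snd k) / sqrt n)\<^sup>2) / 2 = 3/8 * (\<Sum>a<m. (z a)\<^sup>2)"
      using n by (simp add: sum_distrib_left sum_divide_distrib)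
    show "(\<integral>\<^sup>+x. ennreal (exp (\<Sum>k\<in>?I. (?c * z (fst k) * J (snd k) / sqrt n) * x k)) \<partial>?\<mu>)
        = ennreal (exp (3/8 * (\<Sum>a<m. (z a)\<^sup>2)))"
      using s by (subst gauss_vec_mgf) simp_all
  qed
  also have "\<dots> = (\<integral>\<^sup>+z. (\<Prod>a<m. ennreal (exp (3/8 * (z a)\<^sup>2))) \<partial>?\<nu>)"
    by (intro nn_integral_cong) (simp add: exp_sum prod_ennreal sum_distrib_left)
  also have "\<dots> = (\<Prod>a<m. \<integral>\<^sup>+z. ennreal (exp (3/8 * z\<^sup>2)) \<partial>gauss)"
    by (intro gauss_vec_product) auto
  also have "\<dots> = 2 ^ m" by (simp add: gauss_exp_square del: times_divide_eq_left)
  finally show ?thesis .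
qed

section \<open>Rotation invariance of Gaussian vectors\<close>

text \<open>The density depends on \<open>x\<^sup>2 + y\<^sup>2\<close> only. Invariance of Lebesgue measure is obtained from two
one-dimensional affine substitutions, \<open>u = c x + s y\<close> at fixed \<open>y\<close> and then
\<open>v = (y - s u) / c\<close> at fixed \<open>u\<close>; the second is why \<open>c \<noteq> 0\<close> is required.\<close>

lemma gauss_rotation_nn:
  assumes c: "c\<^sup>2 + s\<^sup>2 = 1" "0 < c" and [measurable]: "f \<in> borel_measurable (gauss \<Otimes>\<^sub>M gauss)"
  shows "(\<integral>\<^sup>+x. \<integral>\<^sup>+y. f (c * x + s * y, c * y - s * x) \<partial>gauss \<partial>gauss) = (\<integral>\<^sup>+x. \<integral>\<^sup>+y. f (x, y) \<partial>gauss \<partial>gauss)"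
proof -
  have f [measurable]: "f \<in> borel_measurable (borel \<Otimes>\<^sub>M borel)"
    using assms(3) by (simp cong: measurable_cong_sets)
  define \<phi> :: "real \<Rightarrow> ennreal" where "\<phi> x = ennreal (std_normal_density x)" for x
  have [measurable]: "\<phi> \<in> borel_measurable borel" unfolding \<phi>_def by measurable
  have eq: "\<phi> x * \<phi> y = \<phi> (c * x + s * y) * \<phi> (c * y - s * x)" for x y
  proof -
    have "(c * x + s * y)\<^sup>2 + (c * y - s * x)\<^sup>2 = (c\<^sup>2 + s\<^sup>2) * (x\<^sup>2 + y\<^sup>2)"
      by (simp add: power2_eq_square algebra_simps)
    then have "- x\<^sup>2 / 2 + - y\<^sup>2 / 2 = - (c * x + s * y)\<^sup>2 / 2 + - (c * y - s * x)\<^sup>2 / 2"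
      using c by simp
    then show ?thesis
      unfolding \<phi>_def normal_density_def by (simp add: ennreal_mult'[symmetric] exp_add[symmetric])
  qed
  \<comment> \<open>The full integrand, density included; it is only evaluated at rotated points below.\<close>
  define g where "g = (\<lambda>p. \<phi> (fst p) * \<phi> (snd p) * f p)"
  have g [measurable]: "g \<in> borel_measurable (borel \<Otimes>\<^sub>M borel)" unfolding g_def by measurable
  have dens: "(\<integral>\<^sup>+x. \<integral>\<^sup>+y. h (x, y) \<partial>gauss \<partial>gauss) = (\<integral>\<^sup>+x. \<integral>\<^sup>+y. \<phi> x * \<phi> y * h (x, y) \<partial>lborel \<partial>lborel)"
    if [measurable]: "h \<in> borel_measurable (borel \<Otimes>\<^sub>M borel)" for h
  proof -
    have "(\<integral>\<^sup>+y. h (x, y) \<partial>gauss) = (\<integral>\<^sup>+y. \<phi> y * h (x, y) \<partial>lborel)" for x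
      unfolding \<phi>_def by (rule nn_integral_density) measurable
    then have "(\<integral>\<^sup>+x. \<integral>\<^sup>+y. h (x, y) \<partial>gauss \<partial>gauss) = (\<integral>\<^sup>+x. \<integral>\<^sup>+y. \<phi> y * h (x, y) \<partial>lborel \<partial>gauss)"
      by simp
    also have "\<dots> = (\<integral>\<^sup>+x. \<phi> x * (\<integral>\<^sup>+y. \<phi> y * h (x, y) \<partial>lborel) \<partial>lborel)"
      unfolding \<phi>_def by (rule nn_integral_density) measurable
    also have "\<dots> = (\<integral>\<^sup>+x. \<integral>\<^sup>+y. \<phi> x * (\<phi> y * h (x, y)) \<partial>lborel \<partial>lborel)"
      by (intro nn_integral_cong nn_integral_cmult[symmetric]) measurable
    finally show ?thesis by (simp only: mult.assoc)
  qed
  have "(\<integral>\<^sup>+x. \<integral>\<^sup>+y. f (c * x + s * y, c * y - s * x) \<partial>gauss \<partial>gauss)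
      = (\<integral>\<^sup>+x. \<integral>\<^sup>+y. g (c * x + s * y, c * y - s * x) \<partial>lborel \<partial>lborel)"
  proof -
    have "\<phi> x * \<phi> y * f (c * x + s * y, c * y - s * x) = g (c * x + s * y, c * y - s * x)" for x y
      unfolding g_def fst_conv snd_conv eq[of x y] ..
    then show ?thesis
      using dens[of "\<lambda>p. f (c * fst p + s * snd p, c * snd p - s * fst p)"] by simp
  qed
  also have "\<dots> = (\<integral>\<^sup>+y. \<integral>\<^sup>+x. g (c * x + s * y, c * y - s * x) \<partial>lborel \<partial>lborel)"
    by (rule lborel_pair.Fubini') measurable
  also have "\<dots> = (\<integral>\<^sup>+y. \<integral>\<^sup>+u. (1 / c) * g (u, (y - s * u) / c) \<partial>lborel \<partial>lborel)"
  proof (rule nn_integral_cong)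
    fix y :: real
    have "(\<integral>\<^sup>+x. g (c * x + s * y, c * y - s * x) \<partial>lborel)
       = ennreal (1 / c) * (\<integral>\<^sup>+u. g (c * (- s * y / c + 1 / c * u) + s * y, c * y - s * (- s * y / c + 1 / c * u)) \<partial>lborel)"
      using c by (subst nn_integral_real_affine[where c = "1 / c" and t = "- s * y / c"]) auto
    also have "\<dots> = ennreal (1 / c) * (\<integral>\<^sup>+u. g (u, (y - s * u) / c) \<partial>lborel)"
    proof -
      have "c * y - s * (- s * y / c + 1 / c * u) = (y - s * u) / c" for u
      proof -
        have "c * y - s * (- s * y / c + 1 / c * u) = ((c\<^sup>2 + s\<^sup>2) * y - s * u) / c"
          using c(2) by (simp add: field_simps power2_eq_square)
        then show ?thesis using c by simp
      qed
      moreover have "c * (- s * y / c + 1 / c * u) + s * y = u" for u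
        using c by (simp add: field_simps)
      ultimately show ?thesis by simp
    qed
    finally show "(\<integral>\<^sup>+x. g (c * x + s * y, c * y - s * x) \<partial>lborel) = (\<integral>\<^sup>+u. (1 / c) * g (u, (y - s * u) / c) \<partial>lborel)"
      by (simp add: nn_integral_cmult)
  qed
  also have "\<dots> = (\<integral>\<^sup>+u. \<integral>\<^sup>+y. (1 / c) * g (u, (y - s * u) / c) \<partial>lborel \<partial>lborel)"
    by (rule lborel_pair.Fubini') measurable
  also have "\<dots> = (\<integral>\<^sup>+u. \<integral>\<^sup>+v. g (u, v) \<partial>lborel \<partial>lborel)"
  proof (rule nn_integral_cong)
    fix u :: real
    have "(\<integral>\<^sup>+y. (1 / c) * g (u, (y - s * u) / c) \<partial>lborel)
       = ennreal c * (\<integral>\<^sup>+v. (1 / c) * g (u, (s * u + c * v - s * u) / c) \<partial>lborel)"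
      using c by (subst nn_integral_real_affine[where c = c and t = "s * u"]) auto
    also have "\<dots> = ennreal c * (ennreal (1 / c) * (\<integral>\<^sup>+v. g (u, v) \<partial>lborel))"
      using c by (simp add: nn_integral_cmult)
    also have "\<dots> = (\<integral>\<^sup>+v. g (u, v) \<partial>lborel)"
      using c by (simp add: mult.assoc[symmetric] ennreal_mult'[symmetric])
    finally show "(\<integral>\<^sup>+y. (1 / c) * g (u, (y - s * u) / c) \<partial>lborel) = (\<integral>\<^sup>+v. g (u, v) \<partial>lborel)" .
  qed
  also have "\<dots> = (\<integral>\<^sup>+x. \<integral>\<^sup>+y. f (x, y) \<partial>gauss \<partial>gauss)"
    by (subst dens) (auto simp: g_def)
  finally show ?thesis .
qed

lemma gauss_rotation:
  assumes c: "c\<^sup>2 + s\<^sup>2 = 1" "0 < c"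
  shows "distr (gauss \<Otimes>\<^sub>M gauss) (gauss \<Otimes>\<^sub>M gauss) (\<lambda>(x, y). (c * x + s * y, c * y - s * x)) = gauss \<Otimes>\<^sub>M gauss"
    (is "distr ?P ?P ?R = ?P")
proof (rule measure_eqI)
  interpret g: prob_space gauss by (rule prob_space_gauss)
  have [measurable]: "?R \<in> ?P \<rightarrow>\<^sub>M ?P" by measurable
  fix A assume "A \<in> sets (distr ?P ?P ?R)"
  then have A [measurable]: "A \<in> sets ?P" by simp
  have "emeasure (distr ?P ?P ?R) A = (\<integral>\<^sup>+p. indicator A p \<partial>distr ?P ?P ?R)"
    using A by (intro nn_integral_indicator[symmetric]) simp
  also have "\<dots> = (\<integral>\<^sup>+p. indicator A (?R p) \<partial>?P)"
    by (rule nn_integral_distr) auto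
  also have "\<dots> = (\<integral>\<^sup>+x. \<integral>\<^sup>+y. indicator A (c * x + s * y, c * y - s * x) \<partial>gauss \<partial>gauss)"
    by (subst g.nn_integral_fst[symmetric]) auto
  also have "\<dots> = (\<integral>\<^sup>+x. \<integral>\<^sup>+y. indicator A (x, y) \<partial>gauss \<partial>gauss)"
    by (rule gauss_rotation_nn[OF c]) measurable
  also have "\<dots> = emeasure ?P A"
    by (subst g.nn_integral_fst) (auto intro: nn_integral_indicator[OF A])
  finally show "emeasure (distr ?P ?P ?R) A = emeasure ?P A" .
qed simp

text \<open>A pair of random vectors with independent components is a vector of independent pairs. This turns
rotations of a pair of Gaussian vectors into a coordinatewise operation.\<close>

lemma PiM_zip:
  assumes I: "finite I" and M: "prob_space M" "prob_space N"
  shows "distr (PiM I (\<lambda>_. M) \<Otimes>\<^sub>M PiM I (\<lambda>_. N)) (PiM I (\<lambda>_. M \<Otimes>\<^sub>M N))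
      (\<lambda>(x, y). \<lambda>k\<in>I. (x k, y k)) = PiM I (\<lambda>_. M \<Otimes>\<^sub>M N)"
proof -
  interpret M: prob_space M by fact
  interpret N: prob_space N by fact
  interpret MN: pair_prob_space M N ..
  interpret M': product_sigma_finite "\<lambda>_. M" ..
  interpret N': product_sigma_finite "\<lambda>_. N" ..
  interpret MN': product_sigma_finite "\<lambda>_. M \<Otimes>\<^sub>M N" ..
  interpret PM: prob_space "PiM I (\<lambda>_. M)" by (intro prob_space_PiM M)
  interpret PN: prob_space "PiM I (\<lambda>_. N)" by (intro prob_space_PiM M)
  let ?P = "PiM I (\<lambda>_. M) \<Otimes>\<^sub>M PiM I (\<lambda>_. N)" and ?Q = "PiM I (\<lambda>_. M \<Otimes>\<^sub>M N)"
  let ?z = "\<lambda>(x, y). \<lambda>k\<in>I. (x k, y k)"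
  have z [measurable]: "?z \<in> ?P \<rightarrow>\<^sub>M ?Q"
    unfolding case_prod_beta by measurable
  show ?thesis
  proof (rule MN'.PiM_eqI[OF I])
    fix A assume A: "\<And>i. i \<in> I \<Longrightarrow> A i \<in> sets (M \<Otimes>\<^sub>M N)"
    have [measurable]: "Pi\<^sub>E I A \<in> sets ?Q" using A I by (intro sets_PiM_I_finite)
    have "emeasure (distr ?P ?Q ?z) (Pi\<^sub>E I A) = (\<integral>\<^sup>+p. indicator (Pi\<^sub>E I A) p \<partial>distr ?P ?Q ?z)"
      by simp
    also have "\<dots> = (\<integral>\<^sup>+p. indicator (Pi\<^sub>E I A) (?z p) \<partial>?P)"
      by (rule nn_integral_distr) auto
    also have "\<dots> = (\<integral>\<^sup>+p. (\<Prod>i\<in>I. indicator (A i) (fst p i, snd p i)) \<partial>?P)"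
      using I by (intro nn_integral_cong) (auto simp: indicator_def PiE_iff split: prod.splits)
    also have "\<dots> = (\<integral>\<^sup>+x. \<integral>\<^sup>+y. (\<Prod>i\<in>I. indicator (A i) (x i, y i)) \<partial>PiM I (\<lambda>_. N) \<partial>PiM I (\<lambda>_. M))"
      using A by (subst PN.nn_integral_fst[symmetric]) auto
    also have "\<dots> = (\<integral>\<^sup>+x. (\<Prod>i\<in>I. \<integral>\<^sup>+v. indicator (A i) (x i, v) \<partial>N) \<partial>PiM I (\<lambda>_. M))"
    proof (rule nn_integral_cong)
      fix x assume "x \<in> space (PiM I (\<lambda>_. M))"
      then have x: "x i \<in> space M" if "i \<in> I" for i using that by (auto simp: space_PiM)
      show "(\<integral>\<^sup>+y. (\<Prod>i\<in>I. indicator (A i) (x i, y i)) \<partial>PiM I (\<lambda>_. N)) = (\<Prod>i\<in>I. \<integral>\<^sup>+v. indicator (A i) (x i, v) \<partial>N)"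
        by (intro N'.product_nn_integral_prod[OF I]
              measurable_compose[OF measurable_Pair1'[OF x] borel_measurable_indicator[OF A]])
    qed
    also have "\<dots> = (\<Prod>i\<in>I. \<integral>\<^sup>+u. \<integral>\<^sup>+v. indicator (A i) (u, v) \<partial>N \<partial>M)"
      by (intro M'.product_nn_integral_prod[OF I] N.borel_measurable_nn_integral_fst
            borel_measurable_indicator A)
    also have "\<dots> = (\<Prod>i\<in>I. emeasure (M \<Otimes>\<^sub>M N) (A i))"
      using A by (intro prod.cong refl) (simp add: N.nn_integral_fst)
    finally show "emeasure (distr ?P ?Q ?z) (Pi\<^sub>E I A) = (\<Prod>i\<in>I. emeasure (M \<Otimes>\<^sub>M N) (A i))" .
  qed simp
qed

lemma gauss_vec_rotation:
  assumes I: "finite I" and c: "c\<^sup>2 + s\<^sup>2 = 1" "0 < c"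
    and f [measurable]: "f \<in> borel_measurable (gauss_vec I \<Otimes>\<^sub>M gauss_vec I)"
  shows "(\<integral>\<^sup>+p. f (\<lambda>k\<in>I. c * fst p k + s * snd p k, \<lambda>k\<in>I. c * snd p k - s * fst p k)
            \<partial>(gauss_vec I \<Otimes>\<^sub>M gauss_vec I))
       = (\<integral>\<^sup>+p. f p \<partial>(gauss_vec I \<Otimes>\<^sub>M gauss_vec I))"
proof -
  interpret g: prob_space gauss by (rule prob_space_gauss)
  interpret gg: pair_prob_space gauss gauss ..
  let ?\<mu> = "gauss_vec I" and ?Q = "PiM I (\<lambda>_. gauss \<Otimes>\<^sub>M gauss)"
  let ?z = "\<lambda>(x, y). \<lambda>k\<in>I. (x k, y k)"
  let ?R = "\<lambda>(x, y). (c * x + s * y, c * y - s * x)"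
  define un :: "('a \<Rightarrow> real \<times> real) \<Rightarrow> ('a \<Rightarrow> real) \<times> ('a \<Rightarrow> real)"
    where "un w = (\<lambda>k\<in>I. fst (w k), \<lambda>k\<in>I. snd (w k))" for w
  have un [measurable]: "un \<in> ?Q \<rightarrow>\<^sub>M ?\<mu> \<Otimes>\<^sub>M ?\<mu>" unfolding un_def by measurable
  have z [measurable]: "?z \<in> (?\<mu> \<Otimes>\<^sub>M ?\<mu>) \<rightarrow>\<^sub>M ?Q" by measurable
  have R [measurable]: "compose I ?R \<in> ?Q \<rightarrow>\<^sub>M ?Q" unfolding compose_def by measurable
  have zip: "distr (?\<mu> \<Otimes>\<^sub>M ?\<mu>) ?Q ?z = ?Q"
    by (rule PiM_zip[OF I prob_space_gauss prob_space_gauss])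
  have rot: "distr ?Q ?Q (compose I ?R) = ?Q"
    by (subst distr_PiM_finite_prob_space'[OF I])
       (auto simp: gg.prob_space_axioms gauss_rotation[OF c])
  have unzip: "un (?z p) = p" if "p \<in> space (?\<mu> \<Otimes>\<^sub>M ?\<mu>)" for p
    using that by (auto simp: un_def space_pair_measure space_PiM PiE_iff intro!: extensionalityI[where A = I])
  have "(\<integral>\<^sup>+p. f (\<lambda>k\<in>I. c * fst p k + s * snd p k, \<lambda>k\<in>I. c * snd p k - s * fst p k) \<partial>(?\<mu> \<Otimes>\<^sub>M ?\<mu>))
      = (\<integral>\<^sup>+p. f (un (compose I ?R (?z p))) \<partial>(?\<mu> \<Otimes>\<^sub>M ?\<mu>))"
    by (intro nn_integral_cong arg_cong[where f = f]) (auto simp: un_def compose_def fun_eq_iff restrict_def split: prod.splits)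
  also have "\<dots> = (\<integral>\<^sup>+w. f (un (compose I ?R w)) \<partial>distr (?\<mu> \<Otimes>\<^sub>M ?\<mu>) ?Q ?z)"
    by (rule nn_integral_distr[symmetric]) measurable
  also have "\<dots> = (\<integral>\<^sup>+w. f (un w) \<partial>distr ?Q ?Q (compose I ?R))"
    unfolding zip by (rule nn_integral_distr[symmetric]) measurable
  also have "\<dots> = (\<integral>\<^sup>+w. f (un w) \<partial>distr (?\<mu> \<Otimes>\<^sub>M ?\<mu>) ?Q ?z)"
    unfolding zip rot ..
  also have "\<dots> = (\<integral>\<^sup>+p. f (un (?z p)) \<partial>(?\<mu> \<Otimes>\<^sub>M ?\<mu>))"
    by (rule nn_integral_distr) measurable
  also have "\<dots> = (\<integral>\<^sup>+p. f p \<partial>(?\<mu> \<Otimes>\<^sub>M ?\<mu>))"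
    using unzip by (intro nn_integral_cong) auto
  finally show ?thesis .
qed

section \<open>Exponential moments by Gaussian interpolation\<close>

text \<open>The assumptions on \<open>F\<close> ask for the chain rule along differentiable paths and for continuity of the
partial derivatives \<open>D k\<close> along continuous paths, which is what the interpolation uses and avoids a
topology on the function space \<open>'i \<Rightarrow> real\<close>. With \<open>Y\<close> an independent copy of \<open>X\<close>,
\<open>E exp (l (F X - E F)) \<le> E exp (l (F X - F Y))\<close>, and the exponent is the integral over \<open>s \<in> [0, 1]\<close> of
\<open>K s\<close>, a multiple of \<open>\<Sum>k. D k X\<^sub>s * Y\<^sub>s k\<close>, where \<open>(X\<^sub>s, Y\<^sub>s)\<close> is the pair rotated by the angle
\<open>s \<pi> / 2\<close>. As this pair is again a pair of independent Gaussian vectors, conditioning on \<open>X\<^sub>s\<close> leaves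
a Gaussian moment generating function, whatever \<open>s\<close> is.\<close>

lemma maurey_pisier:
  fixes F :: "('i \<Rightarrow> real) \<Rightarrow> real" and D :: "'i \<Rightarrow> ('i \<Rightarrow> real) \<Rightarrow> real"
  assumes I: "finite I"
    and F: "integrable (gauss_vec I) F"
    and D: "\<And>k. k \<in> I \<Longrightarrow> D k \<in> borel_measurable (gauss_vec I)"
    and chain: "\<And>p p' t. (\<And>k. k \<in> I \<Longrightarrow> ((\<lambda>t. p t k) has_real_derivative p' k) (at t)) \<Longrightarrow>
        ((\<lambda>t. F (\<lambda>k\<in>I. p t k)) has_real_derivative (\<Sum>k\<in>I. D k (\<lambda>k\<in>I. p t k) * p' k)) (at t)"
    and cont: "\<And>(p :: real \<Rightarrow> _) k t. k \<in> I \<Longrightarrow> (\<And>j. j \<in> I \<Longrightarrow> isCont (\<lambda>t. p t j) t) \<Longrightarrow>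
        isCont (\<lambda>t. D k (\<lambda>j\<in>I. p t j)) t"
  shows "(\<integral>\<^sup>+x. ennreal (exp (l * (F x - integral\<^sup>L (gauss_vec I) F))) \<partial>gauss_vec I)
    \<le> (\<integral>\<^sup>+x. ennreal (exp (l\<^sup>2 * pi\<^sup>2 / 8 * (\<Sum>k\<in>I. (D k x)\<^sup>2))) \<partial>gauss_vec I)"
proof -
  define M where "M = gauss_vec I"
  note [measurable] = D[folded M_def] borel_measurable_integrable[OF F, folded M_def]
  have [measurable]: "(\<lambda>x. x k) \<in> borel_measurable M" if "k \<in> I" for k
    unfolding M_def using that by measurable
  interpret M: prob_space M unfolding M_def by (rule prob_space_gauss_vec)
  interpret MM: pair_prob_space M M ..
  define U where "U = density lborel (\<lambda>s. ennreal (indicator {0..1::real} s))"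
  have U_sets [measurable_cong]: "sets U = sets borel" by (simp add: U_def)
  interpret U: prob_space U
    by standard (simp add: U_def emeasure_density ennreal_indicator)
  interpret UMM: pair_sigma_finite U "M \<Otimes>\<^sub>M M" ..
  define X where "X s p = (\<lambda>k\<in>I. cos (pi/2 * s) * fst p k + sin (pi/2 * s) * snd p k)"
    for s :: real and p :: "('i \<Rightarrow> real) \<times> ('i \<Rightarrow> real)"
  define Y where "Y s p = (\<lambda>k\<in>I. cos (pi/2 * s) * snd p k - sin (pi/2 * s) * fst p k)"
    for s :: real and p :: "('i \<Rightarrow> real) \<times> ('i \<Rightarrow> real)"
  define K where "K s p = - (l * pi/2) * (\<Sum>k\<in>I. D k (X s p) * Y s p k)" for s p
  have [measurable]: "(\<lambda>(s, p). X s p) \<in> U \<Otimes>\<^sub>M (M \<Otimes>\<^sub>M M) \<rightarrow>\<^sub>M M"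
    unfolding X_def M_def by measurable
  have [measurable]: "(\<lambda>(s, p). Y s p) \<in> U \<Otimes>\<^sub>M (M \<Otimes>\<^sub>M M) \<rightarrow>\<^sub>M M"
    unfolding Y_def M_def by measurable
  have K [measurable]: "(\<lambda>(s, p). K s p) \<in> borel_measurable (U \<Otimes>\<^sub>M (M \<Otimes>\<^sub>M M))"
    unfolding K_def by measurable
  have path: "ennreal (exp (l * (F (fst p) - F (snd p)))) \<le> (\<integral>\<^sup>+s. ennreal (exp (K s p)) \<partial>U)"
    if p: "p \<in> space (M \<Otimes>\<^sub>M M)" for p
  proof -
    have ext: "(\<lambda>k\<in>I. fst p k) = fst p" "(\<lambda>k\<in>I. snd p k) = snd p"
      using p by (auto simp: space_pair_measure M_def space_PiM PiE_iff extensional_restrict)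
    have "((\<lambda>s. - l * F (X s p)) has_real_derivative K s p) (at s)" for s
    proof -
      have "((\<lambda>s. F (X s p)) has_real_derivative (\<Sum>k\<in>I. D k (X s p) * (pi/2 * Y s p k))) (at s)"
        unfolding X_def
        by (rule chain[THEN DERIV_cong]) (auto intro!: derivative_eq_intros sum.cong simp: Y_def algebra_simps)
      from DERIV_cmult[OF this, of "- l"] show ?thesis
        by (simp add: K_def sum_distrib_left mult_ac)
    qed
    moreover have Kc: "isCont (\<lambda>s. K s p) s" for s
    proof -
      have "isCont (\<lambda>s. D k (X s p)) s" if "k \<in> I" for k
        unfolding X_def by (rule cont[OF that]) (auto intro!: continuous_intros)
      moreover have "isCont (\<lambda>s. Y s p k) s" if "k \<in> I" for k
        using that by (auto simp: Y_def intro!: continuous_intros)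
      ultimately show ?thesis unfolding K_def by (auto intro!: continuous_intros)
    qed
    ultimately have "has_bochner_integral lborel (\<lambda>s. K s p * indicator {0..1} s) (- l * F (X 1 p) - (- l * F (X 0 p)))"
      by (intro has_bochner_integral_FTC_Icc_real) auto
    moreover have "X 1 p = snd p" "X 0 p = fst p" by (auto simp: X_def ext)
    ultimately have hb: "has_bochner_integral lborel (\<lambda>s. indicator {0..1} s *\<^sub>R K s p) (l * (F (fst p) - F (snd p)))"
      by (simp add: algebra_simps)
    have "(\<lambda>s. K s p) \<in> borel_measurable borel"
      using Kc by (intro borel_measurable_continuous_onI continuous_at_imp_continuous_on) auto
    then have "has_bochner_integral U (\<lambda>s. K s p) (l * (F (fst p) - F (snd p)))"
      unfolding U_def using hb by (intro has_bochner_integral_density) auto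
    then show ?thesis
      using U.exp_expectation_le[of "\<lambda>s. K s p"] by (auto simp: has_bochner_integral_iff)
  qed
  have slice: "(\<integral>\<^sup>+p. ennreal (exp (K s p)) \<partial>(M \<Otimes>\<^sub>M M))
      = (\<integral>\<^sup>+x. ennreal (exp (l\<^sup>2 * pi\<^sup>2 / 8 * (\<Sum>k\<in>I. (D k x)\<^sup>2))) \<partial>M)" if s: "0 \<le> s" "s < 1" for s
  proof -
    have c: "0 < cos (pi/2 * s)"
      using s by (intro cos_gt_zero_pi) (auto intro: less_le_trans[of _ 0])
    define f where "f p = ennreal (exp (- (l * pi/2) * (\<Sum>k\<in>I. D k (fst p) * snd p k)))" for p
    have [measurable]: "f \<in> borel_measurable (M \<Otimes>\<^sub>M M)" unfolding f_def by measurable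
    have "(\<integral>\<^sup>+p. ennreal (exp (K s p)) \<partial>(M \<Otimes>\<^sub>M M)) = (\<integral>\<^sup>+p. f (X s p, Y s p) \<partial>(M \<Otimes>\<^sub>M M))"
      by (simp add: f_def K_def)
    also have "\<dots> = (\<integral>\<^sup>+p. f p \<partial>(M \<Otimes>\<^sub>M M))"
      unfolding X_def Y_def M_def
      by (rule gauss_vec_rotation[OF I _ c]) (auto simp: M_def[symmetric])
    also have "\<dots> = (\<integral>\<^sup>+x. \<integral>\<^sup>+y. f (x, y) \<partial>M \<partial>M)"
      by (rule M.nn_integral_fst[symmetric]) measurable
    also have "\<dots> = (\<integral>\<^sup>+x. \<integral>\<^sup>+y. ennreal (exp (\<Sum>k\<in>I. (- (l * pi/2) * D k x) * y k)) \<partial>M \<partial>M)"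
      by (simp add: f_def sum_distrib_left mult_ac)
    also have "\<dots> = (\<integral>\<^sup>+x. ennreal (exp (l\<^sup>2 * pi\<^sup>2 / 8 * (\<Sum>k\<in>I. (D k x)\<^sup>2))) \<partial>M)"
      unfolding M_def gauss_vec_mgf[OF I]
      by (simp add: power_mult_distrib power_divide sum_distrib_left sum_divide_distrib)
    finally show ?thesis .
  qed
  have "(\<integral>\<^sup>+x. ennreal (exp (l * (F x - integral\<^sup>L M F))) \<partial>M)
      \<le> (\<integral>\<^sup>+x. \<integral>\<^sup>+y. ennreal (exp (l * (F x - F y))) \<partial>M \<partial>M)"
  proof (rule nn_integral_mono)
    fix x
    have "integral\<^sup>L M (\<lambda>y. l * (F x - F y)) = l * (F x - integral\<^sup>L M F)"
      using F by (simp add: M_def[symmetric] M.prob_space)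
    then show "ennreal (exp (l * (F x - integral\<^sup>L M F))) \<le> (\<integral>\<^sup>+y. ennreal (exp (l * (F x - F y))) \<partial>M)"
      using M.exp_expectation_le[of "\<lambda>y. l * (F x - F y)"] F by (simp add: M_def[symmetric] M.prob_space)
  qed
  also have "\<dots> = (\<integral>\<^sup>+p. ennreal (exp (l * (F (fst p) - F (snd p)))) \<partial>(M \<Otimes>\<^sub>M M))"
    by (subst M.nn_integral_fst[symmetric]) auto
  also have "\<dots> \<le> (\<integral>\<^sup>+p. \<integral>\<^sup>+s. ennreal (exp (K s p)) \<partial>U \<partial>(M \<Otimes>\<^sub>M M))"
    by (intro nn_integral_mono path)
  also have "\<dots> = (\<integral>\<^sup>+s. \<integral>\<^sup>+p. ennreal (exp (K s p)) \<partial>(M \<Otimes>\<^sub>M M) \<partial>U)"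
    by (rule UMM.Fubini') measurable
  also have "\<dots> = (\<integral>\<^sup>+s. (\<integral>\<^sup>+x. ennreal (exp (l\<^sup>2 * pi\<^sup>2 / 8 * (\<Sum>k\<in>I. (D k x)\<^sup>2))) \<partial>M) \<partial>U)"
  proof (rule nn_integral_cong_AE)
    \<comment> \<open>At \<open>s = 1\<close> the cosine vanishes and the rotation lemma does not apply; this single point is null.\<close>
    have "AE s in lborel. s \<noteq> (1::real)" by (rule AE_lborel_singleton)
    then have "AE s in U. 0 \<le> s \<and> s < 1"
      unfolding U_def by (subst AE_density) (auto simp: indicator_def elim!: eventually_mono)
    then show "AE s in U. (\<integral>\<^sup>+p. ennreal (exp (K s p)) \<partial>(M \<Otimes>\<^sub>M M))
      = (\<integral>\<^sup>+x. ennreal (exp (l\<^sup>2 * pi\<^sup>2 / 8 * (\<Sum>k\<in>I. (D k x)\<^sup>2))) \<partial>M)"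
      by eventually_elim (use slice in auto)
  qed
  also have "\<dots> = (\<integral>\<^sup>+x. ennreal (exp (l\<^sup>2 * pi\<^sup>2 / 8 * (\<Sum>k\<in>I. (D k x)\<^sup>2))) \<partial>M)"
    by (simp add: U.emeasure_space_1)
  finally show ?thesis by (simp add: M_def)
qed

section \<open>Gaussian smoothing\<close>

lemma nn_gauss_exp_abs_finite: "(\<integral>\<^sup>+z. ennreal (exp (a * \<bar>z\<bar>)) \<partial>gauss) < \<infinity>"
proof -
  have "(\<integral>\<^sup>+z. ennreal (exp (a * \<bar>z\<bar>)) \<partial>gauss) \<le> (\<integral>\<^sup>+z. ennreal (exp (a * z)) + ennreal (exp (- a * z)) \<partial>gauss)"
    by (intro nn_integral_mono) (auto simp: abs_if ennreal_plus[symmetric] simp del: ennreal_plus)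
  also have "\<dots> = ennreal (exp (a\<^sup>2 / 2)) + ennreal (exp ((- a)\<^sup>2 / 2))"
    by (subst nn_integral_add) (auto simp only: gauss_mgf, measurable)
  also have "\<dots> < \<infinity>" by simp
  finally show ?thesis .
qed

text \<open>A class of functions that is closed under multiplication by \<open>z\<close> and \<open>exp (h z)\<close> and consists of
functions integrable against the Gaussian measure, so that Laplace transforms of its members can be
differentiated repeatedly under the integral.\<close>

definition exp_growth :: "(real \<Rightarrow> real) \<Rightarrow> bool" where
  "exp_growth W \<longleftrightarrow> W \<in> borel_measurable borel \<and> (\<exists>C a. \<forall>z. \<bar>W z\<bar> \<le> C * exp (a * \<bar>z\<bar>))"

lemma integrable_exp_growth:
  assumes "exp_growth W" shows "integrable gauss W"
proof -
  from assms obtain C a where [measurable]: "W \<in> borel_measurable borel"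
    and W: "\<And>z. \<bar>W z\<bar> \<le> C * exp (a * \<bar>z\<bar>)" unfolding exp_growth_def by auto
  have "integrable gauss (\<lambda>z. exp (a * \<bar>z\<bar>))"
    using nn_gauss_exp_abs_finite[of a] by (intro integrableI_nonneg) auto
  then have 1: "integrable gauss (\<lambda>z. C * exp (a * \<bar>z\<bar>))" by (rule integrable_mult_right)
  have 2: "norm (W z) \<le> norm (C * exp (a * \<bar>z\<bar>))" for z
    using order_trans[OF W abs_ge_self] by simp
  show ?thesis
    by (rule Bochner_Integration.integrable_bound[OF 1]) (use 2 in simp_all)
qed

lemma exp_growth_mult:
  assumes "exp_growth V" "exp_growth W" shows "exp_growth (\<lambda>z. V z * W z)"
proof -
  from assms obtain C a C' a' where [measurable]: "V \<in> borel_measurable borel" "W \<in> borel_measurable borel"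
    and V: "\<And>z. \<bar>V z\<bar> \<le> C * exp (a * \<bar>z\<bar>)" and W: "\<And>z. \<bar>W z\<bar> \<le> C' * exp (a' * \<bar>z\<bar>)"
    unfolding exp_growth_def by auto
  have "\<bar>V z * W z\<bar> \<le> (C * C') * exp ((a + a') * \<bar>z\<bar>)" for z
  proof -
    have "\<bar>V z * W z\<bar> \<le> (C * exp (a * \<bar>z\<bar>)) * (C' * exp (a' * \<bar>z\<bar>))"
      unfolding abs_mult using V[of z] W[of z] by (intro mult_mono) (auto intro: order_trans[OF abs_ge_zero])
    then show ?thesis by (simp add: exp_add algebra_simps)
  qed
  then show ?thesis unfolding exp_growth_def by (auto intro!: exI)
qed

lemma exp_growth_basic:
  "exp_growth (\<lambda>z. z)" "exp_growth (\<lambda>z. exp (a * z))" "exp_growth (\<lambda>z. exp (a * \<bar>z\<bar>))"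
proof -
  have "\<bar>z\<bar> \<le> 1 * exp (1 * \<bar>z\<bar>)" for z :: real
    using exp_ge_add_one_self[of "\<bar>z\<bar>"] by (simp; linarith)
  then show "exp_growth (\<lambda>z. z)" unfolding exp_growth_def by (intro conjI exI[of _ 1] allI) auto
  have "a * z \<le> \<bar>a\<bar> * \<bar>z\<bar>" for z by (metis abs_mult abs_ge_self)
  then have "\<bar>exp (a * z)\<bar> \<le> 1 * exp (\<bar>a\<bar> * \<bar>z\<bar>)" for z by simp
  then show "exp_growth (\<lambda>z. exp (a * z))"
    unfolding exp_growth_def by (intro conjI exI[of _ 1] exI[of _ "\<bar>a\<bar>"] allI) auto
  show "exp_growth (\<lambda>z. exp (a * \<bar>z\<bar>))" unfolding exp_growth_def by (intro conjI exI[of _ 1] exI[of _ a] allI) auto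
qed

lemma exp_growth_bounded: "V \<in> borel_measurable borel \<Longrightarrow> (\<And>z. \<bar>V z\<bar> \<le> C) \<Longrightarrow> exp_growth V"
  unfolding exp_growth_def by (intro conjI exI[of _ C] exI[of _ 0]) auto

lemma exp_taylor_bound: "\<bar>exp u - 1 - u\<bar> \<le> u\<^sup>2 * exp \<bar>u\<bar>" for u :: real
proof -
  obtain t where t: "\<bar>t\<bar> \<le> \<bar>u\<bar>" "exp u = (\<Sum>m<2. u ^ m / fact m) + exp t / fact 2 * u ^ 2"
    using Maclaurin_exp_le[of u 2] by auto
  have "\<bar>exp u - 1 - u\<bar> = exp t / 2 * u\<^sup>2"
    unfolding t(2) by (simp add: numeral_2_eq_2)
  also have "\<dots> \<le> exp \<bar>u\<bar> * u\<^sup>2"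
  proof (rule mult_right_mono)
    have "exp t \<le> exp \<bar>u\<bar>" using t(1) by simp
    then show "exp t / 2 \<le> exp \<bar>u\<bar>" using exp_gt_zero[of "\<bar>u\<bar>"] by linarith
  qed simp
  finally show ?thesis by (simp add: mult.commute)
qed

text \<open>The second-order Taylor remainder of \<open>exp\<close> is bounded by \<open>d\<^sup>2\<close> times the function \<open>\<bar>R z\<bar>\<close> of exponential
growth, uniformly for \<open>\<bar>d\<bar> \<le> 1\<close>; integrating it shows that the difference quotients converge.\<close>

lemma gauss_laplace_deriv:
  assumes W: "exp_growth W"
  shows "((\<lambda>h. LINT z|gauss. W z * exp (h * z)) has_real_derivative
           (LINT z|gauss. W z * z * exp (h * z))) (at h)"
proof -
  define R where "R z = W z * z * z * exp ((\<bar>h\<bar> + 1) * \<bar>z\<bar>)" for z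
  define m where "m h = (LINT z|gauss. W z * exp (h * z))" for h
  define m' where "m' = (LINT z|gauss. W z * z * exp (h * z))"
  note G = exp_growth_mult exp_growth_basic W integrable_exp_growth
  have [simp]: "integrable gauss (\<lambda>z. W z * exp (h * z))" for h by (intro G)
  have [simp]: "integrable gauss (\<lambda>z. W z * z * exp (h * z))" for h by (intro G)
  have R [simp]: "integrable gauss (\<lambda>z. \<bar>R z\<bar>)" unfolding R_def by (intro integrable_abs G)
  have bound: "\<bar>m (h + d) - m h - d * m'\<bar> \<le> d\<^sup>2 * (LINT z|gauss. \<bar>R z\<bar>)" if d: "\<bar>d\<bar> \<le> 1" for d
  proof -
    have eq: "m (h + d) - m h - d * m' = (LINT z|gauss. W z * exp ((h + d) * z) - W z * exp (h * z) - d * (W z * z * exp (h * z)))"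
      unfolding m_def m'_def by simp
    have "\<bar>m (h + d) - m h - d * m'\<bar> \<le> (LINT z|gauss. \<bar>W z * exp ((h + d) * z) - W z * exp (h * z) - d * (W z * z * exp (h * z))\<bar>)"
      unfolding eq by (rule integral_abs_bound)
    also have "\<dots> \<le> (LINT z|gauss. d\<^sup>2 * \<bar>R z\<bar>)"
    proof (rule integral_mono)
      fix z :: real
      have "\<bar>exp (d * z) - 1 - d * z\<bar> \<le> (d * z)\<^sup>2 * exp \<bar>d * z\<bar>"
        by (rule exp_taylor_bound)
      also have "\<dots> \<le> (d * z)\<^sup>2 * exp \<bar>z\<bar>"
        using d by (intro mult_left_mono) (auto simp: abs_mult mult_left_le_one_le)
      finally have 1: "\<bar>exp (d * z) - 1 - d * z\<bar> \<le> (d * z)\<^sup>2 * exp \<bar>z\<bar>" .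
      have "h * z \<le> \<bar>h\<bar> * \<bar>z\<bar>" by (metis abs_mult abs_ge_self)
      then have 2: "exp (h * z) \<le> exp (\<bar>h\<bar> * \<bar>z\<bar>)" by simp
      have "\<bar>W z * exp ((h + d) * z) - W z * exp (h * z) - d * (W z * z * exp (h * z))\<bar>
          = \<bar>W z\<bar> * (exp (h * z) * \<bar>exp (d * z) - 1 - d * z\<bar>)"
      proof -
        have "W z * exp ((h + d) * z) - W z * exp (h * z) - d * (W z * z * exp (h * z))
            = W z * (exp (h * z) * (exp (d * z) - 1 - d * z))"
          by (simp add: exp_add algebra_simps)
        then show ?thesis by (simp only: abs_mult abs_exp_cancel)
      qed
      also have "\<dots> \<le> \<bar>W z\<bar> * (exp (\<bar>h\<bar> * \<bar>z\<bar>) * ((d * z)\<^sup>2 * exp \<bar>z\<bar>))"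
        by (intro mult_left_mono mult_mono 1 2) auto
      also have "\<dots> = d\<^sup>2 * \<bar>R z\<bar>"
        by (simp add: R_def abs_mult power2_eq_square exp_add algebra_simps)
      finally show "\<bar>W z * exp ((h + d) * z) - W z * exp (h * z) - d * (W z * z * exp (h * z))\<bar> \<le> d\<^sup>2 * \<bar>R z\<bar>" .
    qed auto
    finally show ?thesis by simp
  qed
  define C where "C = (LINT z|gauss. \<bar>R z\<bar>)"
  have "(\<lambda>d. (m (h + d) - m h) / d) \<midarrow>0\<rightarrow> m'"
  proof (rule LIM_zero_cancel, rule tendsto_rabs_zero_cancel, rule tendsto_sandwich)
    show "\<forall>\<^sub>F d in at 0. 0 \<le> \<bar>(m (h + d) - m h) / d - m'\<bar>" by simp
    have "\<bar>(m (h + d) - m h) / d - m'\<bar> \<le> C * \<bar>d\<bar>" if "\<bar>d\<bar> \<le> 1" "d \<noteq> 0" for d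
    proof -
      have "\<bar>(m (h + d) - m h) / d - m'\<bar> = \<bar>m (h + d) - m h - d * m'\<bar> / \<bar>d\<bar>"
        using that(2) by (simp add: abs_divide[symmetric] diff_divide_distrib)
      also have "\<dots> \<le> d\<^sup>2 * C / \<bar>d\<bar>"
        unfolding C_def using bound[OF that(1)] by (intro divide_right_mono) auto
      also have "\<dots> = C * \<bar>d\<bar>" using that(2) by (simp add: power2_eq_square abs_if)
      finally show ?thesis .
    qed
    then show "\<forall>\<^sub>F d in at 0. \<bar>(m (h + d) - m h) / d - m'\<bar> \<le> C * \<bar>d\<bar>"
      unfolding eventually_at by (intro exI[of _ 1]) (auto simp: dist_real_def)
    show "((\<lambda>d. C * \<bar>d\<bar>) \<longlongrightarrow> 0) (at 0)" by (auto intro!: tendsto_eq_intros)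
  qed auto
  then show ?thesis unfolding m_def m'_def DERIV_def .
qed

text \<open>Moving the shift from \<open>U\<close> into the Gaussian density (Cameron--Martin) exhibits the smoothed function
as an explicit Gaussian factor times a Laplace transform. Its smoothness is then independent
of any regularity of \<open>U\<close>.\<close>

lemma smoothed_eq_laplace:
  assumes U [measurable]: "U \<in> borel_measurable borel" and "0 < \<eta>"
  shows "smoothed U \<eta> x = exp (- (x / \<eta>)\<^sup>2 / 2) * (LINT z|gauss. U (\<eta> * z) * exp (x / \<eta> * z))"
proof -
  have "smoothed U \<eta> x = (LINT z|lborel. std_normal_density z * U (x + \<eta> * z))"
    unfolding smoothed_def by (subst integral_real_density) auto
  also have "\<dots> = (LINT z|lborel. std_normal_density (- (x / \<eta>) + 1 * z) * U (x + \<eta> * (- (x / \<eta>) + 1 * z)))"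
    using lborel_integral_real_affine[of 1 "\<lambda>z. std_normal_density z * U (x + \<eta> * z)" "- (x / \<eta>)"]
    by simp
  also have "\<dots> = (LINT z|lborel. exp (- (x / \<eta>)\<^sup>2 / 2) * (std_normal_density z * (U (\<eta> * z) * exp (x / \<eta> * z))))"
  proof (rule Bochner_Integration.integral_cong[OF refl])
    fix z
    have "x + \<eta> * (- (x / \<eta>) + 1 * z) = \<eta> * z" using assms(2) by (simp add: field_simps)
    moreover have "std_normal_density (- (x / \<eta>) + 1 * z)
        = exp (- (x / \<eta>)\<^sup>2 / 2) * (std_normal_density z * exp (x / \<eta> * z))"
    proof -
      have "- (- h + 1 * z)\<^sup>2 / 2 = - h\<^sup>2 / 2 + (- z\<^sup>2 / 2 + h * z)" for h :: real
        by (simp add: power2_eq_square field_simps)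
      from this[of "x / \<eta>"] show ?thesis unfolding std_normal_density_def by (simp add: exp_add[symmetric])
    qed
    ultimately show "std_normal_density (- (x / \<eta>) + 1 * z) * U (x + \<eta> * (- (x / \<eta>) + 1 * z))
      = exp (- (x / \<eta>)\<^sup>2 / 2) * (std_normal_density z * (U (\<eta> * z) * exp (x / \<eta> * z)))"
      by simp
  qed
  also have "\<dots> = exp (- (x / \<eta>)\<^sup>2 / 2) * (LINT z|gauss. U (\<eta> * z) * exp (x / \<eta> * z))"
    by (subst integral_real_density) auto
  finally show ?thesis .
qed

lemma smoothed_C1:
  assumes U [measurable]: "U \<in> borel_measurable borel" and U01: "\<And>x. U x \<in> {0..1}" and \<eta>: "0 < \<eta>"
  obtains V' where "\<And>x. (smoothed U \<eta> has_real_derivative V' x) (at x)" "\<And>x. isCont V' x"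
proof -
  define m where "m h = (LINT z|gauss. U (\<eta> * z) * exp (h * z))" for h
  define m' where "m' h = (LINT z|gauss. U (\<eta> * z) * z * exp (h * z))" for h
  have W: "exp_growth (\<lambda>z. U (\<eta> * z))"
    by (rule exp_growth_bounded[of _ 1]) (use U01 in auto)
  have m: "(m has_real_derivative m' h) (at h)" for h
    unfolding m_def m'_def using gauss_laplace_deriv[OF W] by simp
  have "\<exists>D. (m' has_real_derivative D) (at h)" for h
    unfolding m'_def using gauss_laplace_deriv[OF exp_growth_mult[OF W exp_growth_basic(1)]] by blast
  then have m'c: "isCont m' h" for h using DERIV_isCont by blast
  have mc: "isCont m h" for h using m DERIV_isCont by blast
  have eq: "smoothed U \<eta> = (\<lambda>x. exp (- (x / \<eta>)\<^sup>2 / 2) * m (x / \<eta>))"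
    using smoothed_eq_laplace[OF U \<eta>] by (auto simp: m_def)
  show thesis
  proof (rule that)
    fix x
    have e: "((\<lambda>x. exp (- (x / \<eta>)\<^sup>2 / 2)) has_real_derivative - (x / \<eta>\<^sup>2) * exp (- (x / \<eta>)\<^sup>2 / 2)) (at x)"
      using \<eta> by (auto intro!: derivative_eq_intros simp: power2_eq_square)
    have mm: "((\<lambda>x. m (x / \<eta>)) has_real_derivative m' (x / \<eta>) * (1 / \<eta>)) (at x)"
      by (rule DERIV_chain2[OF m DERIV_cdivide[OF DERIV_ident]])
    show "(smoothed U \<eta> has_real_derivative
        - (x / \<eta>\<^sup>2) * exp (- (x / \<eta>)\<^sup>2 / 2) * m (x / \<eta>) + m' (x / \<eta>) * (1 / \<eta>) * exp (- (x / \<eta>)\<^sup>2 / 2)) (at x)"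
      unfolding eq by (rule DERIV_mult[OF e mm])
    have "isCont (\<lambda>x. x / \<eta>) x" using \<eta> by (intro continuous_intros) simp
    note c = isCont_o2[OF this m'c] isCont_o2[OF this mc]
    show "isCont (\<lambda>x. - (x / \<eta>\<^sup>2) * exp (- (x / \<eta>)\<^sup>2 / 2) * m (x / \<eta>)
        + m' (x / \<eta>) * (1 / \<eta>) * exp (- (x / \<eta>)\<^sup>2 / 2)) x"
      using \<eta> by (intro continuous_intros c) simp_all
  qed
qed

lemma integrable_smoothed:
  fixes U :: "real \<Rightarrow> real"
  assumes U [measurable]: "U \<in> borel_measurable borel" and U01: "\<And>x. U x \<in> {0..1}"
  shows "integrable gauss (\<lambda>\<xi>. U (x + \<eta> * \<xi>))"
proof -
  have "\<bar>U (x + \<eta> * \<xi>)\<bar> \<le> 1" for \<xi> using U01[of "x + \<eta> * \<xi>"] by simp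
  then have "exp_growth (\<lambda>\<xi>. U (x + \<eta> * \<xi>))"
    by (intro exp_growth_bounded[where C = 1]) simp_all
  then show ?thesis by (rule integrable_exp_growth)
qed

text \<open>If the smoothed function vanished at one point, \<open>U\<close> would vanish almost everywhere, because the
Gaussian density is positive; then its first Hermite coefficient would vanish.\<close>

lemma smoothed_pos:
  assumes U [measurable]: "U \<in> borel_measurable borel" and U01: "\<And>x. U x \<in> {0..1}" and \<eta>: "0 < \<eta>"
    and nd: "(LINT \<xi>|gauss. \<xi> * U \<xi>) \<noteq> 0"
  shows "0 < smoothed U \<eta> x"
proof (rule ccontr)
  have U0: "0 \<le> U y" for y using U01[of y] by simp
  assume "\<not> 0 < smoothed U \<eta> x"
  moreover have "0 \<le> smoothed U \<eta> x"
    unfolding smoothed_def by (rule Bochner_Integration.integral_nonneg) (rule U0)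
  ultimately have "(LINT \<xi>|gauss. U (x + \<eta> * \<xi>)) = 0" by (simp add: smoothed_def)
  then have "AE \<xi> in gauss. U (x + \<eta> * \<xi>) = 0"
    by (subst (asm) integral_nonneg_eq_0_iff_AE[OF integrable_smoothed[OF U U01]]) (simp_all add: U0)
  then have "AE \<xi> in lborel. U (x + \<eta> * \<xi>) = 0"
    by (subst (asm) AE_density) (simp_all add: normal_density_pos)
  then have "AE \<xi> in lborel. ennreal (U (x + \<eta> * \<xi>)) = 0"
    by eventually_elim simp
  then have "(\<integral>\<^sup>+\<xi>. ennreal (U (x + \<eta> * \<xi>)) \<partial>lborel) = 0"
    by (subst nn_integral_0_iff_AE) simp_all
  then have "(\<integral>\<^sup>+\<xi>. ennreal (U \<xi>) \<partial>lborel) = 0"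
    using nn_integral_real_affine[of "\<lambda>\<xi>. ennreal (U \<xi>)" \<eta> x] \<eta> by simp
  then have "AE \<xi> in lborel. ennreal (U \<xi>) = 0"
    by (subst (asm) nn_integral_0_iff_AE) simp_all
  then have "AE \<xi> in lborel. \<xi> * U \<xi> = 0"
    by eventually_elim (use U0 in \<open>auto simp: ennreal_eq_0_iff intro: antisym\<close>)
  then have "AE \<xi> in gauss. \<xi> * U \<xi> = 0"
    by (subst AE_density) (auto elim!: eventually_mono)
  then have "(LINT \<xi>|gauss. \<xi> * U \<xi>) = 0"
    by (rule integral_eq_zero_AE)
  with nd show False by simp
qed

lemma smoothed_le_1:
  assumes U [measurable]: "U \<in> borel_measurable borel" and U01: "\<And>x. U x \<in> {0..1}"
  shows "smoothed U \<eta> x \<le> 1"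
proof -
  interpret g: prob_space gauss by (rule prob_space_gauss)
  have "smoothed U \<eta> x \<le> (LINT z|gauss. 1)"
    unfolding smoothed_def
    by (rule integral_mono[OF integrable_smoothed[OF U U01]]) (use U01 in simp_all)
  then show ?thesis using g.prob_space by simp
qed

section \<open>The free energy of the perceptron\<close>

text \<open>Here \<open>L\<close> stands for \<open>log U\<^sub>\<eta>\<close> and \<open>u\<close> for its derivative.\<close>

locale perceptron =
  fixes L u :: "real \<Rightarrow> real" and C :: real and m n :: nat
  assumes n_pos: "0 < n" and C_nonneg: "0 \<le> C"
    and L_deriv: "\<And>x. (L has_real_derivative u x) (at x)"
    and u_cont: "\<And>x. isCont u x"
    and u_growth: "\<And>x. \<bar>u x\<bar> \<le> C * (1 + \<bar>x\<bar>)"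
    and L_nonpos: "\<And>x. L x \<le> 0"
begin

definition idx :: "(nat \<times> nat) set" where "idx = {..<m} \<times> {..<n}"
definition spins :: "(nat \<Rightarrow> real) set" where "spins = {..<n} \<rightarrow>\<^sub>E {-1, 1}"
definition \<Delta> :: "(nat \<times> nat \<Rightarrow> real) \<Rightarrow> (nat \<Rightarrow> real) \<Rightarrow> nat \<Rightarrow> real" where
  "\<Delta> x J a = (\<Sum>i<n. x (a, i) * J i) / sqrt n"
definition weight :: "(nat \<times> nat \<Rightarrow> real) \<Rightarrow> (nat \<Rightarrow> real) \<Rightarrow> real" where
  "weight x J = exp (\<Sum>a<m. L (\<Delta> x J a))"
definition Z :: "(nat \<times> nat \<Rightarrow> real) \<Rightarrow> real" where
  "Z x = (\<Sum>J\<in>spins. weight x J)"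
definition logZ :: "(nat \<times> nat \<Rightarrow> real) \<Rightarrow> real" where
  "logZ x = ln (Z x)"
definition dlogZ :: "nat \<times> nat \<Rightarrow> (nat \<times> nat \<Rightarrow> real) \<Rightarrow> real" where
  "dlogZ k x = (\<Sum>J\<in>spins. weight x J / Z x * (u (\<Delta> x J (fst k)) * J (snd k) / sqrt n))"
definition \<mu> :: "(nat \<times> nat \<Rightarrow> real) measure" where
  "\<mu> = gauss_vec idx"

lemma finite_idx: "finite idx" by (simp add: idx_def)

lemma finite_spins: "finite spins" by (simp add: spins_def finite_PiE)

lemma card_spins: "card spins = 2 ^ n"
  unfolding spins_def by (subst card_PiE) (simp_all add: numeral_2_eq_2)

lemma spins_nonempty: "spins \<noteq> {}"
  unfolding spins_def by (simp add: PiE_eq_empty_iff)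

lemma spin_square: "J \<in> spins \<Longrightarrow> i < n \<Longrightarrow> (J i)\<^sup>2 = 1"
  unfolding spins_def by (force simp: PiE_iff)

lemma weight_pos: "0 < weight x J" by (simp add: weight_def)

lemma Z_pos: "0 < Z x"
  unfolding Z_def using finite_spins spins_nonempty weight_pos by (intro sum_pos) auto

lemma gibbs_total: "(\<Sum>J\<in>spins. weight x J / Z x) = 1"
  using Z_pos[of x] by (simp add: sum_divide_distrib[symmetric] Z_def[symmetric])

lemma \<Delta>_restrict: "a < m \<Longrightarrow> \<Delta> (\<lambda>k\<in>idx. x k) J a = \<Delta> x J a"
  unfolding \<Delta>_def idx_def by simp

lemma weight_restrict: "weight (\<lambda>k\<in>idx. x k) J = weight x J"
  unfolding weight_def by (simp add: \<Delta>_restrict)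

lemma Z_restrict: "Z (\<lambda>k\<in>idx. x k) = Z x"
  unfolding Z_def by (simp add: weight_restrict)

lemma logZ_restrict: "logZ (\<lambda>k\<in>idx. x k) = logZ x"
  unfolding logZ_def by (simp add: Z_restrict)

lemma dlogZ_restrict: "k \<in> idx \<Longrightarrow> dlogZ k (\<lambda>k\<in>idx. x k) = dlogZ k x"
  using \<Delta>_restrict[of "fst k"] unfolding dlogZ_def weight_restrict Z_restrict by (simp add: idx_def mem_Times_iff)

text \<open>The derivative of \<open>log Z\<close> is the Gibbs average of the derivative of the energy; exchanging the
average with the sum over the matrix entries gives the partial derivatives.\<close>

lemma logZ_chain:
  assumes p: "\<And>k. k \<in> idx \<Longrightarrow> ((\<lambda>t. p t k) has_real_derivative p' k) (at t)"
  shows "((\<lambda>t. logZ (p t)) has_real_derivative (\<Sum>k\<in>idx. dlogZ k (p t) * p' k)) (at t)"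
proof -
  define \<Delta>' where "\<Delta>' J a = (\<Sum>i<n. p' (a, i) * J i) / sqrt n" for J a
  have \<Delta>: "((\<lambda>t. \<Delta> (p t) J a) has_real_derivative \<Delta>' J a) (at t)" if "a < m" for J a
    unfolding \<Delta>_def \<Delta>'_def using that
    by (intro DERIV_cdivide DERIV_sum DERIV_cmult_right p) (auto simp: idx_def)
  have "((\<lambda>t. weight (p t) J) has_real_derivative
      weight (p t) J * (\<Sum>a<m. u (\<Delta> (p t) J a) * \<Delta>' J a)) (at t)" for J
    unfolding weight_def
    by (rule DERIV_chain2[OF DERIV_exp], intro DERIV_sum DERIV_chain2[OF L_deriv] \<Delta>) simp
  then have "((\<lambda>t. Z (p t)) has_real_derivative
      (\<Sum>J\<in>spins. weight (p t) J * (\<Sum>a<m. u (\<Delta> (p t) J a) * \<Delta>' J a))) (at t)"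
    unfolding Z_def by (intro DERIV_sum)
  from DERIV_chain2[OF DERIV_ln[OF Z_pos] this]
  have "((\<lambda>t. logZ (p t)) has_real_derivative
      (\<Sum>J\<in>spins. weight (p t) J / Z (p t) * (\<Sum>a<m. u (\<Delta> (p t) J a) * \<Delta>' J a))) (at t)"
    unfolding logZ_def by (simp add: sum_distrib_left divide_inverse mult_ac)
  also have "(\<Sum>J\<in>spins. weight (p t) J / Z (p t) * (\<Sum>a<m. u (\<Delta> (p t) J a) * \<Delta>' J a))
      = (\<Sum>J\<in>spins. \<Sum>k\<in>idx. weight (p t) J / Z (p t) * (u (\<Delta> (p t) J (fst k)) * J (snd k) / sqrt n) * p' k)"
    unfolding idx_def sum.cartesian_product' \<Delta>'_def
    by (simp add: sum_distrib_left sum_distrib_right sum_divide_distrib mult_ac)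
  also have "\<dots> = (\<Sum>k\<in>idx. dlogZ k (p t) * p' k)"
    unfolding dlogZ_def sum_distrib_right by (rule sum.swap)
  finally show ?thesis .
qed

lemma dlogZ_isCont:
  fixes t :: real and p :: "real \<Rightarrow> nat \<times> nat \<Rightarrow> real"
  assumes k: "k \<in> idx" and p: "\<And>j. j \<in> idx \<Longrightarrow> isCont (\<lambda>t. p t j) t"
  shows "isCont (\<lambda>t. dlogZ k (p t)) t"
proof -
  have L: "isCont L x" for x using L_deriv DERIV_isCont by blast
  have \<Delta>: "isCont (\<lambda>t. \<Delta> (p t) J a) t" if "a < m" for J a
    unfolding \<Delta>_def using that n_pos by (intro continuous_intros p) (auto simp: idx_def)
  have w: "isCont (\<lambda>t. weight (p t) J) t" for J
    unfolding weight_def by (intro continuous_intros isCont_o2[OF \<Delta> L]) simp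
  have Z: "isCont (\<lambda>t. Z (p t)) t"
    unfolding Z_def by (intro continuous_intros w)
  have "Z (p t) \<noteq> 0" using Z_pos[of "p t"] by simp
  moreover have "fst k < m" using k by (auto simp: idx_def)
  ultimately show ?thesis
    unfolding dlogZ_def using n_pos by (intro continuous_intros w Z isCont_o2[OF \<Delta> u_cont]) simp_all
qed

text \<open>Each partial derivative is a Gibbs average, so by Jensen its square is at most the average of the
squares. There the factors \<open>(J i)\<^sup>2 / n = 1 / n\<close> sum to 1 over a row, which leaves
\<open>\<Sum>a<m. (u (\<Delta> x J a))\<^sup>2\<close>. The bound \<open>q\<close> has to hold for all spin vectors as nothing is known about
the Gibbs measure.\<close>

lemma gradient_bound:
  fixes q :: real
  assumes q: "\<And>J. J \<in> spins \<Longrightarrow> (\<Sum>a<m. (\<Delta> x J a)\<^sup>2) \<le> q"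
  shows "(\<Sum>k\<in>idx. (dlogZ k x)\<^sup>2) \<le> 2 * C\<^sup>2 * (m + q)"
proof -
  define g where "g J = weight x J / Z x" for J
  have g0: "0 \<le> g J" for J using weight_pos[of x J] Z_pos[of x] by (simp add: g_def)
  have g1: "(\<Sum>J\<in>spins. g J) = 1" using gibbs_total by (simp add: g_def)
  have jensen: "(\<Sum>J\<in>spins. g J * v J)\<^sup>2 \<le> (\<Sum>J\<in>spins. g J * (v J)\<^sup>2)" for v
  proof -
    \<comment> \<open>The difference of the two sides is the variance of \<open>v\<close> under \<open>g\<close>.\<close>
    define b where "b = (\<Sum>J\<in>spins. g J * v J)"
    have "0 \<le> (\<Sum>J\<in>spins. g J * (v J - b)\<^sup>2)" using g0 by (intro sum_nonneg) auto
    also have "\<dots> = (\<Sum>J\<in>spins. g J * (v J)\<^sup>2) - 2 * b * (\<Sum>J\<in>spins. g J * v J) + b\<^sup>2 * (\<Sum>J\<in>spins. g J)"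
      unfolding sum_distrib_left sum_subtractf[symmetric] sum.distrib[symmetric]
      by (intro sum.cong refl) (simp add: power2_eq_square algebra_simps)
    finally show ?thesis by (simp add: b_def[symmetric] g1 power2_eq_square)
  qed
  have "(\<Sum>k\<in>idx. (dlogZ k x)\<^sup>2) \<le> (\<Sum>k\<in>idx. \<Sum>J\<in>spins. g J * ((u (\<Delta> x J (fst k)))\<^sup>2 / n))"
  proof (rule sum_mono)
    fix k assume k: "k \<in> idx"
    have "(dlogZ k x)\<^sup>2 \<le> (\<Sum>J\<in>spins. g J * (u (\<Delta> x J (fst k)) * J (snd k) / sqrt n)\<^sup>2)"
      unfolding dlogZ_def g_def[symmetric] by (rule jensen)
    also have "\<dots> = (\<Sum>J\<in>spins. g J * ((u (\<Delta> x J (fst k)))\<^sup>2 / n))"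
      using k by (intro sum.cong refl) (auto simp: power_mult_distrib power_divide spin_square idx_def)
    finally show "(dlogZ k x)\<^sup>2 \<le> (\<Sum>J\<in>spins. g J * ((u (\<Delta> x J (fst k)))\<^sup>2 / n))" .
  qed
  also have "\<dots> = (\<Sum>J\<in>spins. \<Sum>k\<in>idx. g J * ((u (\<Delta> x J (fst k)))\<^sup>2 / n))"
    by (rule sum.swap)
  also have "\<dots> = (\<Sum>J\<in>spins. g J * (\<Sum>a<m. (u (\<Delta> x J a))\<^sup>2))"
    unfolding idx_def sum.cartesian_product' using n_pos by (simp add: sum_distrib_left)
  also have "\<dots> \<le> (\<Sum>J\<in>spins. g J * (2 * C\<^sup>2 * (m + q)))"
  proof (rule sum_mono)
    fix J assume J: "J \<in> spins"
    have "(\<Sum>a<m. (u (\<Delta> x J a))\<^sup>2) \<le> (\<Sum>a<m. 2 * C\<^sup>2 * (1 + (\<Delta> x J a)\<^sup>2))"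
    proof (rule sum_mono)
      fix a
      let ?d = "\<Delta> x J a"
      have "(u ?d)\<^sup>2 \<le> (C * (1 + \<bar>?d\<bar>))\<^sup>2"
        using u_growth[of ?d] by (intro power2_le_iff_abs_le[THEN iffD2]) (auto intro: order_trans)
      also have "\<dots> \<le> C\<^sup>2 * (2 * (1 + ?d\<^sup>2))"
      proof -
        have "(1 + \<bar>?d\<bar>)\<^sup>2 \<le> 2 * (1 + ?d\<^sup>2)"
          using zero_le_power2[of "1 - \<bar>?d\<bar>"] by (simp add: power2_eq_square algebra_simps)
        then show ?thesis unfolding power_mult_distrib by (intro mult_left_mono) auto
      qed
      finally show "(u ?d)\<^sup>2 \<le> 2 * C\<^sup>2 * (1 + ?d\<^sup>2)" by (simp only: mult_ac)
    qed
    also have "\<dots> = 2 * C\<^sup>2 * (m + (\<Sum>a<m. (\<Delta> x J a)\<^sup>2))"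
      by (simp add: sum_distrib_left[symmetric] sum.distrib)
    also have "\<dots> \<le> 2 * C\<^sup>2 * (m + q)"
      using q[OF J] by (intro mult_left_mono) auto
    finally show "g J * (\<Sum>a<m. (u (\<Delta> x J a))\<^sup>2) \<le> g J * (2 * C\<^sup>2 * (m + q))"
      by (intro mult_left_mono g0)
  qed
  also have "\<dots> = 2 * C\<^sup>2 * (m + q)"
    unfolding sum_distrib_right[symmetric] g1 by simp
  finally show ?thesis .
qed

lemma L_measurable [measurable]: "L \<in> borel_measurable borel"
  using DERIV_isCont[OF L_deriv]
  by (intro borel_measurable_continuous_onI continuous_at_imp_continuous_on) simp

lemma u_measurable [measurable]: "u \<in> borel_measurable borel"
  using u_cont by (intro borel_measurable_continuous_onI continuous_at_imp_continuous_on) simp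

lemma \<Delta>_measurable [measurable]: "a < m \<Longrightarrow> (\<lambda>x. \<Delta> x J a) \<in> borel_measurable \<mu>"
proof -
  assume a: "a < m"
  have [measurable]: "(\<lambda>x. x (a, i)) \<in> borel_measurable \<mu>" if "i < n" for i
  proof -
    have "(\<lambda>x. x (a, i)) \<in> \<mu> \<rightarrow>\<^sub>M gauss"
      unfolding \<mu>_def using that a by (intro measurable_component_singleton) (simp add: idx_def)
    then show ?thesis by (simp cong: measurable_cong_sets)
  qed
  show ?thesis
    unfolding \<Delta>_def by (intro borel_measurable_divide borel_measurable_sum borel_measurable_times) auto
qed

lemma weight_measurable [measurable]: "(\<lambda>x. weight x J) \<in> borel_measurable \<mu>"
  unfolding weight_def
  by (intro measurable_compose[OF _ borel_measurable_exp] borel_measurable_sum measurable_compose[OF \<Delta>_measurable L_measurable]) simp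

lemma Z_measurable [measurable]: "Z \<in> borel_measurable \<mu>"
  unfolding Z_def by measurable

lemma logZ_measurable [measurable]: "logZ \<in> borel_measurable \<mu>"
  unfolding logZ_def by measurable

lemma dlogZ_measurable: "k \<in> idx \<Longrightarrow> dlogZ k \<in> borel_measurable \<mu>"
proof -
  assume "k \<in> idx"
  then have [measurable]: "(\<lambda>x. u (\<Delta> x J (fst k))) \<in> borel_measurable \<mu>" for J
    by (intro measurable_compose[OF \<Delta>_measurable u_measurable]) (auto simp: idx_def)
  show ?thesis unfolding dlogZ_def by measurable
qed

lemma exp_square_overlap:
  assumes J: "J \<in> spins"
  shows "(\<integral>\<^sup>+x. ennreal (exp (3/8 * (\<Sum>a<m. (\<Delta> x J a)\<^sup>2))) \<partial>\<mu>) = 2 ^ m"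
  unfolding \<mu>_def idx_def \<Delta>_def by (rule gauss_rows_exp_square[OF spin_square[OF J] n_pos])

lemma L_lower: "L 0 - 2 * C * (1 + y\<^sup>2) \<le> L y"
proof -
  have "norm (L y - L 0) \<le> C * (1 + \<bar>y\<bar>) * norm (y - 0)"
  proof (rule field_differentiable_bound[of "{-\<bar>y\<bar>..\<bar>y\<bar>}" L u])
    show "norm (u z) \<le> C * (1 + \<bar>y\<bar>)" if "z \<in> {-\<bar>y\<bar>..\<bar>y\<bar>}" for z
    proof -
      have "C * (1 + \<bar>z\<bar>) \<le> C * (1 + \<bar>y\<bar>)" using that C_nonneg by (intro mult_left_mono) auto
      then show ?thesis using u_growth[of z] by simp
    qed
  qed (use L_deriv in \<open>auto intro: DERIV_subset\<close>)
  then have 1: "L 0 - L y \<le> C * ((1 + \<bar>y\<bar>) * \<bar>y\<bar>)" by simp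
  have "(1 + \<bar>y\<bar>) * \<bar>y\<bar> \<le> 2 * (1 + y\<^sup>2)"
    using zero_le_power2[of "1 - \<bar>y\<bar>"] by (simp add: power2_eq_square algebra_simps)
  then have "C * ((1 + \<bar>y\<bar>) * \<bar>y\<bar>) \<le> C * (2 * (1 + y\<^sup>2))" using C_nonneg by (rule mult_left_mono)
  with 1 show ?thesis by (simp add: algebra_simps)
qed

text \<open>Above, \<open>log Z\<close> is bounded by the logarithm of the number of spin vectors. Below, a single spin vector
contributes the sum of the \<open>L\<close>, which is at least a negative quadratic function of the overlaps; a
quadratic function is dominated by its exponential, whose expectation is finite.\<close>

lemma logZ_integrable: "integrable \<mu> logZ"
proof -
  interpret prob_space \<mu> unfolding \<mu>_def by (rule prob_space_gauss_vec)
  obtain J where J: "J \<in> spins" using spins_nonempty by auto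
  define S where "S x = (\<Sum>a<m. (\<Delta> x J a)\<^sup>2)" for x
  have [measurable]: "S \<in> borel_measurable \<mu>"
    unfolding S_def by (intro borel_measurable_sum borel_measurable_power \<Delta>_measurable) simp
  have S: "integrable \<mu> (\<lambda>x. exp (3/8 * S x))"
  proof (rule integrableI_nonneg)
    show "(\<integral>\<^sup>+x. ennreal (exp (3/8 * S x)) \<partial>\<mu>) < \<infinity>"
      unfolding S_def exp_square_overlap[OF J] by (simp add: power_less_top_ennreal)
  qed auto
  define B where "B = n * ln 2 + m * \<bar>L 0\<bar> + 2 * C * m"
  have "norm (logZ x) \<le> norm (B + 16/3 * C * exp (3/8 * S x))" for x
  proof -
    have "Z x \<le> (\<Sum>J\<in>spins. 1)"
      unfolding Z_def weight_def using L_nonpos by (intro sum_mono) (simp add: sum_nonpos)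
    then have "Z x \<le> 2 ^ n" by (simp add: card_spins)
    then have "logZ x \<le> ln (2 ^ n)" unfolding logZ_def using Z_pos[of x] by simp
    then have up: "logZ x \<le> n * ln 2" by (simp add: ln_realpow)
    have "weight x J \<le> Z x"
      unfolding Z_def using weight_pos J finite_spins by (intro member_le_sum) (auto intro: less_imp_le)
    then have "ln (weight x J) \<le> logZ x" unfolding logZ_def using weight_pos Z_pos by simp
    then have "(\<Sum>a<m. L (\<Delta> x J a)) \<le> logZ x" by (simp add: weight_def)
    moreover have "(\<Sum>a<m. L 0 - 2 * C * (1 + (\<Delta> x J a)\<^sup>2)) \<le> (\<Sum>a<m. L (\<Delta> x J a))"
      by (intro sum_mono L_lower)
    moreover have "(\<Sum>a<m. L 0 - 2 * C * (1 + (\<Delta> x J a)\<^sup>2)) = m * L 0 - 2 * C * (m + S x)"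
      unfolding S_def sum_subtractf sum_distrib_left[symmetric] sum.distrib by simp
    ultimately have "m * L 0 - 2 * C * (m + S x) \<le> logZ x" by simp
    moreover have "- (m * \<bar>L 0\<bar>) \<le> m * L 0"
      using mult_left_mono[of "- \<bar>L 0\<bar>" "L 0" "real m"] by simp
    moreover have "S x \<le> 8/3 * exp (3/8 * S x)"
      using exp_ge_add_one_self[of "3/8 * S x"] by (simp only: field_simps)
    then have "2 * C * S x \<le> 2 * C * (8/3 * exp (3/8 * S x))"
      using C_nonneg by (intro mult_left_mono) auto
    moreover have "0 \<le> real n * ln 2" "0 \<le> C * m" "0 \<le> C * exp (3/8 * S x)" "0 \<le> m * \<bar>L 0\<bar>"
      using C_nonneg by auto
    moreover have "2 * C * (m + S x) = 2 * (C * m) + 2 * C * S x" by (simp add: algebra_simps)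
    ultimately have "\<bar>logZ x\<bar> \<le> n * ln 2 + m * \<bar>L 0\<bar> + 2 * (C * m) + 16/3 * (C * exp (3/8 * S x))"
      using up by (intro abs_leI) linarith+
    then show ?thesis by (simp add: B_def mult_ac)
  qed
  moreover have "integrable \<mu> (\<lambda>x. B + 16/3 * C * exp (3/8 * S x))" using S by simp
  ultimately show ?thesis
    by (intro Bochner_Integration.integrable_bound[of \<mu> "\<lambda>x. B + 16/3 * C * exp (3/8 * S x)" logZ] AE_I2) auto
qed

lemma exp_mult_le_convex: "0 \<le> p \<Longrightarrow> p \<le> 1 \<Longrightarrow> exp (p * v) \<le> 1 - p + p * exp v" for p v :: real
  using convex_onD[OF exp_convex, of p 0 v] by simp

text \<open>With \<open>T = \<Sum>J. exp (3/8 |x J|\<^sup>2 / n)\<close>, all the quadratic forms \<open>S J x\<close> are at most \<open>8/3 ln T\<close>, so the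
integrand is bounded by a constant times \<open>T powr p\<close> with \<open>p = 8/3 c \<le> 1\<close>. By concavity of this power,
in the form of its tangent at \<open>4 ^ n\<close>, a bound \<open>E T \<le> 4 ^ n\<close> yields \<open>E T powr p \<le> 4 ^ (n p)\<close>.
Passing to the power \<open>p\<close> makes the entropy cost \<open>ln 4\<close> of the union bound proportional to \<open>c\<close>; a
union bound for \<open>exp (c S J)\<close> itself would cost \<open>n ln 2\<close> even for small \<open>c\<close>.\<close>

lemma exp_gradient_bound:
  assumes c: "0 \<le> c" "c \<le> 3/8" and mn: "m \<le> n" and CC: "b * (2 * C\<^sup>2) \<le> c" "0 \<le> b"
  shows "(\<integral>\<^sup>+x. ennreal (exp (b * (\<Sum>k\<in>idx. (dlogZ k x)\<^sup>2))) \<partial>\<mu>)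
      \<le> ennreal (exp (c * n * (1 + 16/3 * ln 2)))"
proof -
  interpret prob_space \<mu> unfolding \<mu>_def by (rule prob_space_gauss_vec)
  define S where "S J x = (\<Sum>a<m. (\<Delta> x J a)\<^sup>2)" for J x
  define T where "T x = (\<Sum>J\<in>spins. exp (3/8 * S J x))" for x
  define p where "p = 8/3 * c"
  have p: "0 \<le> p" "p \<le> 1" using c by (auto simp: p_def)
  have [measurable]: "S J \<in> borel_measurable \<mu>" for J
    unfolding S_def by (intro borel_measurable_sum borel_measurable_power \<Delta>_measurable) simp
  have [measurable]: "T \<in> borel_measurable \<mu>" unfolding T_def by measurable
  have T_pos: "0 < T x" for x
    unfolding T_def using finite_spins spins_nonempty by (intro sum_pos) auto
  have ET: "(\<integral>\<^sup>+x. ennreal (T x) \<partial>\<mu>) \<le> 4 ^ n"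
  proof -
    have "(\<integral>\<^sup>+x. ennreal (T x) \<partial>\<mu>) = (\<integral>\<^sup>+x. (\<Sum>J\<in>spins. ennreal (exp (3/8 * S J x))) \<partial>\<mu>)"
      unfolding T_def by simp
    also have "\<dots> = (\<Sum>J\<in>spins. \<integral>\<^sup>+x. ennreal (exp (3/8 * S J x)) \<partial>\<mu>)"
      by (rule nn_integral_sum) measurable
    also have "\<dots> = (\<Sum>J\<in>spins. 2 ^ m)"
      unfolding S_def by (rule sum.cong[OF refl exp_square_overlap])
    also have "\<dots> = 2 ^ n * 2 ^ m" by (simp add: card_spins)
    also have "\<dots> \<le> 2 ^ n * 2 ^ n" using mn by (intro mult_left_mono power_increasing) auto
    also have "\<dots> = (4 ^ n :: ennreal)" by (simp flip: power_mult_distrib)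
    finally show ?thesis .
  qed
  define A where "A = exp (c * n + p * ln (4 ^ n))"
  have bound: "exp (b * (\<Sum>k\<in>idx. (dlogZ k x)\<^sup>2)) \<le> A * (1 - p) + A * p / 4 ^ n * T x" for x
  proof -
    define q where "q = 8/3 * ln (T x)"
    have Sq: "S J x \<le> q" if "J \<in> spins" for J
    proof -
      have "exp (3/8 * S J x) \<le> T x"
        unfolding T_def using that finite_spins by (intro member_le_sum) auto
      then have "3/8 * S J x \<le> ln (T x)" by (subst ln_ge_iff[OF T_pos])
      then show ?thesis by (simp add: q_def)
    qed
    have "(\<Sum>k\<in>idx. (dlogZ k x)\<^sup>2) \<le> 2 * C\<^sup>2 * (m + q)"
      by (rule gradient_bound) (use Sq in \<open>simp add: S_def\<close>)
    then have "b * (\<Sum>k\<in>idx. (dlogZ k x)\<^sup>2) \<le> b * (2 * C\<^sup>2 * (m + q))"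
      using CC(2) by (rule mult_left_mono)
    also have "\<dots> = b * (2 * C\<^sup>2) * (m + q)" by simp
    also have "\<dots> \<le> c * (m + q)"
    proof (rule mult_right_mono[OF CC(1)])
      obtain J where "J \<in> spins" using spins_nonempty by auto
      then have "S J x \<le> q" by (rule Sq)
      moreover have "0 \<le> S J x" by (simp add: S_def sum_nonneg)
      ultimately show "0 \<le> m + q" by simp
    qed
    also have "\<dots> \<le> c * (n + q)" using mn c by (intro mult_left_mono) auto
    also have "\<dots> = (c * n + p * ln (4 ^ n)) + p * (ln (T x) - ln (4 ^ n))"
      by (simp add: p_def q_def algebra_simps diff_divide_distrib)
    finally have "exp (b * (\<Sum>k\<in>idx. (dlogZ k x)\<^sup>2)) \<le> A * exp (p * (ln (T x) - ln (4 ^ n)))"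
      unfolding A_def exp_add[symmetric] by simp
    also have "\<dots> \<le> A * (1 - p + p * exp (ln (T x) - ln (4 ^ n)))"
      using p by (intro mult_left_mono exp_mult_le_convex) (auto simp: A_def)
    also have "exp (ln (T x) - ln (4 ^ n)) = T x / 4 ^ n"
      using T_pos[of x] by (simp add: exp_diff)
    finally show ?thesis by (simp add: algebra_simps)
  qed
  have A: "0 \<le> A" by (simp add: A_def)
  have "(\<integral>\<^sup>+x. ennreal (exp (b * (\<Sum>k\<in>idx. (dlogZ k x)\<^sup>2))) \<partial>\<mu>)
      \<le> (\<integral>\<^sup>+x. ennreal (A * (1 - p)) + ennreal (A * p / 4 ^ n) * ennreal (T x) \<partial>\<mu>)"
    using bound A p T_pos less_imp_le[OF T_pos]
    by (intro nn_integral_mono) (simp add: ennreal_mult[symmetric] ennreal_plus[symmetric] ennreal_leI del: ennreal_plus)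
  also have "\<dots> = ennreal (A * (1 - p)) + ennreal (A * p / 4 ^ n) * (\<integral>\<^sup>+x. ennreal (T x) \<partial>\<mu>)"
    by (subst nn_integral_add) (auto simp: nn_integral_cmult emeasure_space_1)
  also have "\<dots> \<le> ennreal (A * (1 - p)) + ennreal (A * p / 4 ^ n) * ennreal (4 ^ n)"
    using ET by (intro add_left_mono mult_left_mono) (auto simp flip: ennreal_power)
  also have "\<dots> = ennreal (A * (1 - p)) + ennreal (A * p)"
    using A p by (simp add: ennreal_mult[symmetric])
  also have "\<dots> = ennreal (A * (1 - p) + A * p)"
    using A p by (intro ennreal_plus[symmetric]) auto
  also have "A * (1 - p) + A * p = A" by (simp add: algebra_simps)
  also have "A = exp (c * n * (1 + 16/3 * ln 2))"
  proof -
    have "ln (4 ^ n) = n * (2 * ln (2::real))"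
      using ln_realpow[of 2 2] by (simp add: ln_realpow)
    then show ?thesis unfolding A_def p_def by (simp add: algebra_simps)
  qed
  finally show ?thesis .
qed

theorem logZ_mgf:
  assumes mn: "m \<le> n" and l: "l\<^sup>2 * pi\<^sup>2 * C\<^sup>2 / 4 \<le> 3/8"
  shows "(\<integral>\<^sup>+x. ennreal (exp (l * (logZ x - integral\<^sup>L \<mu> logZ))) \<partial>\<mu>)
      \<le> ennreal (exp (l\<^sup>2 * pi\<^sup>2 * C\<^sup>2 / 4 * n * (1 + 16/3 * ln 2)))"
proof -
  have "(\<integral>\<^sup>+x. ennreal (exp (l * (logZ x - integral\<^sup>L \<mu> logZ))) \<partial>\<mu>)
      \<le> (\<integral>\<^sup>+x. ennreal (exp (l\<^sup>2 * pi\<^sup>2 / 8 * (\<Sum>k\<in>idx. (dlogZ k x)\<^sup>2))) \<partial>\<mu>)"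
    unfolding \<mu>_def
  proof (rule maurey_pisier[OF finite_idx])
    show "integrable (gauss_vec idx) logZ" using logZ_integrable by (simp add: \<mu>_def)
    show "dlogZ k \<in> borel_measurable (gauss_vec idx)" if "k \<in> idx" for k
      using dlogZ_measurable[OF that] by (simp add: \<mu>_def)
  next
    fix p :: "real \<Rightarrow> _" and p' t assume "\<And>k. k \<in> idx \<Longrightarrow> ((\<lambda>t. p t k) has_real_derivative p' k) (at t)"
    from logZ_chain[OF this]
    show "((\<lambda>t. logZ (\<lambda>k\<in>idx. p t k)) has_real_derivative (\<Sum>k\<in>idx. dlogZ k (\<lambda>k\<in>idx. p t k) * p' k)) (at t)"
      by (simp add: logZ_restrict dlogZ_restrict)
  next
    fix p :: "real \<Rightarrow> nat \<times> nat \<Rightarrow> real" and k t assume *: "k \<in> idx" "\<And>j. j \<in> idx \<Longrightarrow> isCont (\<lambda>t. p t j) t"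
    from dlogZ_isCont[where k = k and p = p and t = t, OF *] *(1)
    show "isCont (\<lambda>t. dlogZ k (\<lambda>j\<in>idx. p t j)) t" by (simp add: dlogZ_restrict)
  qed
  also have "\<dots> \<le> ennreal (exp (l\<^sup>2 * pi\<^sup>2 * C\<^sup>2 / 4 * n * (1 + 16/3 * ln 2)))"
    using l mn by (intro exp_gradient_bound) auto
  finally show ?thesis .
qed

end

section \<open>Size of the constant in the singular value bound\<close>

text \<open>A Taylor estimate shows \<open>cos (17/10) < 0\<close>, so \<open>\<pi>/2 < 17/10\<close>.\<close>

lemma pi_less_17_5: "pi < 17/5"
proof (rule ccontr)
  assume "\<not> pi < 17/5"
  then have "0 \<le> cos (17/10 :: real)" by (intro cos_ge_zero) auto
  moreover obtain t where "cos (17/10 :: real)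
      = (\<Sum>i<6. cos_coeff i * (17/10) ^ i) + cos (t + 1/2 * real 6 * pi) / fact 6 * (17/10) ^ 6"
    using Maclaurin_cos_expansion[of "17/10" 6] by auto
  moreover have "cos (t + 1/2 * real 6 * pi) / fact 6 * (17/10) ^ 6 \<le> 1 / fact 6 * (17/10) ^ 6"
    by (intro mult_right_mono divide_right_mono) auto
  moreover have "{..<6 :: nat} = {0, 1, 2, 3, 4, 5}" by auto
  then have "(\<Sum>i<6. cos_coeff i * (17/10) ^ i) = 1 - (17/10)^2 / 2 + (17/10 :: real)^4 / 24"
    by (simp add: cos_coeff_def fact_numeral)
  moreover have "1 - (17/10)^2 / 2 + (17/10)^4 / 24 + 1 / fact 6 * (17/10) ^ 6 < (0 :: real)"
    by (simp add: fact_numeral power_divide)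
  ultimately show False by linarith
qed

lemma s_max_1x1: "s_max (Matrix.mat 1 1 A) = \<bar>A (0, 0)\<bar>"
proof -
  let ?a = "A (0, 0)" and ?A = "Matrix.mat 1 1 A :: real mat"
  let ?B = "transpose_mat ?A * ?A"
  have entry: "vec_index (?B *\<^sub>v v) 0 = ?a\<^sup>2 * vec_index v 0" if "v \<in> carrier_vec 1" for v
    using that by (simp add: scalar_prod_def power2_eq_square)
  have "eigenvalue ?B k \<longleftrightarrow> k = ?a\<^sup>2" for k
  proof
    assume "eigenvalue ?B k"
    then obtain v where v: "v \<in> carrier_vec 1" "v \<noteq> 0\<^sub>v 1" "?B *\<^sub>v v = k \<cdot>\<^sub>v v"
      unfolding eigenvalue_def eigenvector_def by auto
    have "vec_index v 0 \<noteq> 0"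
    proof
      assume "vec_index v 0 = 0"
      then have "v = 0\<^sub>v 1" using v(1) by (intro eq_vecI) auto
      with v(2) show False by simp
    qed
    moreover have "?a\<^sup>2 * vec_index v 0 = k * vec_index v 0"
      using arg_cong[OF v(3), of "\<lambda>w. vec_index w 0"] v(1) unfolding entry[OF v(1)] by simp
    ultimately show "k = ?a\<^sup>2" by simp
  next
    assume k: "k = ?a\<^sup>2"
    let ?v = "Matrix.vec 1 (\<lambda>_. 1 :: real)"
    have "?B *\<^sub>v ?v = k \<cdot>\<^sub>v ?v"
      using entry[of ?v] by (intro eq_vecI) (auto simp: k)
    moreover have "?v \<noteq> 0\<^sub>v 1" by (auto simp: vec_eq_iff)
    ultimately show "eigenvalue ?B k"
      unfolding eigenvalue_def eigenvector_def by (intro exI[of _ ?v]) auto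
  qed
  then have "singular_values ?A = {\<bar>?a\<bar>}"
    unfolding singular_values_def by (auto simp: power2_eq_iff)
  then show ?thesis by (simp add: s_max_def)
qed

lemma gauss_tail_lower:
  assumes "0 \<le> v" shows "std_normal_density (v + 1) \<le> measure gauss {z. v \<le> \<bar>z\<bar>}"
proof -
  interpret prob_space gauss by (rule prob_space_gauss)
  have dec: "std_normal_density (v + 1) \<le> std_normal_density z" if "z \<in> {v..v+1}" for z
  proof -
    have "z\<^sup>2 \<le> (v + 1)\<^sup>2" using that assms by (intro power_mono) auto
    then show ?thesis unfolding std_normal_density_def by (intro mult_left_mono) auto
  qed
  have "ennreal (std_normal_density (v + 1)) = (\<integral>\<^sup>+z. ennreal (std_normal_density (v + 1)) * indicator {v..v+1} z \<partial>lborel)"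
    by (subst nn_integral_cmult_indicator) auto
  also have "\<dots> \<le> (\<integral>\<^sup>+z. ennreal (std_normal_density z) * indicator {z. v \<le> \<bar>z\<bar>} z \<partial>lborel)"
    using dec assms by (intro nn_integral_mono) (auto simp: indicator_def ennreal_leI)
  also have "\<dots> = emeasure gauss {z. v \<le> \<bar>z\<bar>}"
    by (subst emeasure_density) auto
  finally show ?thesis by (simp add: emeasure_eq_measure)
qed

text \<open>For \<open>1 \<times> 1\<close> matrices the largest singular value is the modulus of one standard Gaussian variable, whose
tail is at least the density one unit further out, of order \<open>exp (- t\<^sup>2 / 2)\<close>. For \<open>C < 9/5\<close> the assumed
bound \<open>2 exp (- t\<^sup>2 / C)\<close> is smaller than that at \<open>t = 50\<close>.\<close>

lemma edge_constant_lower: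
  assumes C: "1 \<le> C"
    and tail: "\<And>t. 0 \<le> t \<Longrightarrow> measure (gaussian_matrix 1 1)
        {A \<in> space (gaussian_matrix 1 1). s_max (Matrix.mat 1 1 A) \<ge> sqrt C + t} \<le> 2 * exp (- (t\<^sup>2 / C))"
  shows "9/5 \<le> C"
proof (rule ccontr)
  assume "\<not> 9/5 \<le> C"
  then have C': "C < 9/5" by simp
  let ?I = "{..<1} \<times> {..<1} :: (nat \<times> nat) set"
  define v where "v = sqrt C + 50"
  \<comment> \<open>\<open>(27/20)\<^sup>2\<close> is slightly above \<open>9/5\<close>, and \<open>27/20 + 50 + 1 = 1047/20\<close>.\<close>
  have "sqrt C \<le> sqrt ((27/20)\<^sup>2)"
    using C' by (intro real_sqrt_le_mono) (simp add: power2_eq_square)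
  then have v: "0 \<le> v" "v + 1 \<le> 1047/20" using C by (auto simp: v_def)
  let ?S = "{A \<in> space (gaussian_matrix 1 1). v \<le> s_max (Matrix.mat 1 1 A)}"
  have I: "?I = {(0, 0)}" by auto
  have S: "?S = {A \<in> space (gaussian_matrix 1 1). v \<le> \<bar>A (0, 0)\<bar>}"
    unfolding s_max_1x1 ..
  have [measurable]: "(\<lambda>A. A (0, 0)) \<in> borel_measurable (gaussian_matrix 1 1)"
    unfolding gaussian_matrix_def
    by (rule measurable_compose[OF measurable_component_singleton measurable_ident_sets]) auto
  have "emeasure (gaussian_matrix 1 1) ?S = (\<integral>\<^sup>+A. indicator ?S A \<partial>gaussian_matrix 1 1)"
    unfolding S by (rule nn_integral_indicator[symmetric]) measurable
  also have "\<dots> = (\<integral>\<^sup>+A. (\<Prod>k\<in>?I. indicator {z. v \<le> \<bar>z\<bar>} (A k)) \<partial>gauss_vec ?I)"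
    unfolding S unfolding I gaussian_matrix_def by (intro nn_integral_cong) (simp add: indicator_def)
  also have "\<dots> = (\<Prod>k\<in>?I. \<integral>\<^sup>+z. indicator {z. v \<le> \<bar>z\<bar>} z \<partial>gauss)"
    by (rule gauss_vec_product) auto
  also have "\<dots> = emeasure gauss {z. v \<le> \<bar>z\<bar>}" unfolding I by simp
  finally have "measure (gaussian_matrix 1 1) ?S = measure gauss {z. v \<le> \<bar>z\<bar>}"
    by (simp add: measure_def)
  then have "std_normal_density (v + 1) \<le> 2 * exp (- (50\<^sup>2 / C))"
    using tail[of 50] gauss_tail_lower[OF v(1)] by (simp add: v_def)
  also have "\<dots> \<le> 2 * exp (- (50\<^sup>2 / (9/5)))"
  proof -
    have "50\<^sup>2 / (9/5) \<le> 50\<^sup>2 / C" using C C' by (intro divide_left_mono) auto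
    then show ?thesis by simp
  qed
  finally have upper: "std_normal_density (v + 1) \<le> 2 * exp (- 12500/9)" by simp
  \<comment> \<open>Up to the factor 8 for the prefactors, the exponents to compare are \<open>- 1371\<close> and \<open>- 12500/9 < - 1371 - 17\<close>.\<close>
  have "(v + 1)\<^sup>2 \<le> (1047/20)\<^sup>2" using v by (intro power_mono) auto
  then have "- 1371 \<le> - (v + 1)\<^sup>2 / 2" by (simp add: power2_eq_square)
  moreover have "sqrt (2 * pi) \<le> 4"
    using pi_less_4 real_sqrt_le_mono[of "2 * pi" 16] by simp
  ultimately have "1/4 * exp (- 1371) \<le> std_normal_density (v + 1)"
    unfolding std_normal_density_def by (intro mult_mono) (auto intro!: frac_le)
  with upper have "exp (- 1371) \<le> 8 * exp (- 12500/9 :: real)" by linarith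
  also have "exp (- 12500/9 :: real) \<le> exp (- 1371 - 17)" by simp
  also have "8 * exp (- 1371 - 17) = exp (- 1371) * (8 / exp (17::real))"
    by (simp only: exp_diff) simp
  also have "8 / exp (17::real) < 1"
    using exp_ge_add_one_self[of 17] by simp
  finally show False by simp
qed

section \<open>Concentration of the free energy\<close>

text \<open>The empty index set is treated separately since the characterisation of independence by product
measures needs a nonempty one.\<close>

lemma distr_gauss_vec:
  assumes P: "prob_space P" and I: "finite I"
    and indep: "prob_space.indep_vars P (\<lambda>_. borel) G I"
    and law: "\<And>k. k \<in> I \<Longrightarrow> distributed P lborel (G k) std_normal_density"
  shows "distr P (gauss_vec I) (\<lambda>\<omega>. \<lambda>k\<in>I. G k \<omega>) = gauss_vec I"
proof (cases "I = {}")
  case True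
  interpret prob_space P by fact
  interpret g: product_prob_space "\<lambda>_ :: 'b. gauss" "{}"
    by (rule product_prob_spaceI) (rule prob_space_gauss)
  show ?thesis
    unfolding True
  proof (rule g.PiM_eqI)
    fix A :: "'b \<Rightarrow> real set"
    let ?X = "\<lambda>\<omega>. \<lambda>k\<in>{}. G k \<omega>"
    have "emeasure (distr P (gauss_vec {}) ?X) (Pi\<^sub>E {} A) = emeasure P (?X -` Pi\<^sub>E {} A \<inter> space P)"
      by (rule emeasure_distr, rule measurable_restrict) (simp_all add: PiM_empty)
    also have "?X -` Pi\<^sub>E {} A \<inter> space P = space P" by auto
    also note emeasure_space_1
    finally show "emeasure (distr P (gauss_vec {}) ?X) (Pi\<^sub>E {} A) = (\<Prod>k\<in>{}. emeasure gauss (A k))"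
      unfolding prod.empty .
  qed simp_all
next
  case False
  interpret prob_space P by fact
  have d: "distr P borel (G k) = gauss" if "k \<in> I" for k
    using distributed_distr_eq_density[OF law[OF that]] by (simp cong: distr_cong)
  have m: "random_variable borel (G k)" if "k \<in> I" for k
    using distributed_measurable[OF law[OF that]] by simp
  have "distr P (gauss_vec I) (\<lambda>\<omega>. \<lambda>k\<in>I. G k \<omega>) = distr P (PiM I (\<lambda>_. borel)) (\<lambda>\<omega>. \<lambda>k\<in>I. G k \<omega>)"
    by (intro distr_cong refl sets_PiM_cong) simp_all
  also have "\<dots> = PiM I (\<lambda>k. distr P borel (G k))"
    using indep_vars_iff_distr_eq_PiM'[OF False m] indep by simp
  also have "\<dots> = gauss_vec I" by (intro PiM_cong refl d)
  finally show ?thesis .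
qed

lemma (in prob_space) exponential_Markov:
  fixes H :: "'a \<Rightarrow> real"
  assumes [measurable]: "random_variable borel H" and B: "(\<integral>\<^sup>+x. ennreal (exp (H x)) \<partial>M) \<le> ennreal B" "0 \<le> B"
  shows "prob {x \<in> space M. s \<le> H x} \<le> B * exp (- s)"
proof -
  have "emeasure M {x \<in> space M. s \<le> H x} = (\<integral>\<^sup>+x. indicator {x \<in> space M. s \<le> H x} x \<partial>M)" by simp
  also have "\<dots> \<le> (\<integral>\<^sup>+x. ennreal (exp (- s)) * ennreal (exp (H x)) \<partial>M)"
    by (intro nn_integral_mono) (auto simp: indicator_def ennreal_mult[symmetric] exp_add[symmetric])
  also have "\<dots> = ennreal (exp (- s)) * (\<integral>\<^sup>+x. ennreal (exp (H x)) \<partial>M)"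
    by (rule nn_integral_cmult) measurable
  also have "\<dots> \<le> ennreal (exp (- s)) * ennreal B"
    by (intro mult_left_mono B) simp
  also have "\<dots> = ennreal (B * exp (- s))" using B by (simp add: ennreal_mult[symmetric] mult.commute)
  finally show ?thesis using B by (simp add: emeasure_eq_measure)
qed

text \<open>In terms of \<open>r = y\<^sup>2 / (C\<^sub>1\<^sup>2 C\<^sub>2)\<close>, which is at most 25, the exponent is \<open>N r\<close> times
\<open>(1 + 16/3 ln 2) / (64 C\<^sub>2) - 1 / (4 \<pi>)\<close>, which for \<open>C\<^sub>2 \<ge> 9/5\<close> is just below \<open>- 1/32\<close>. The multiplier
\<open>l\<close> is the one with \<open>l \<pi> C\<^sub>1 / 2 = \<surd>r / (8 \<surd>C\<^sub>2)\<close>, a round value near the minimiser.\<close>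

lemma optimised_exponent:
  fixes C\<^sub>1 C\<^sub>2 y N :: real
  assumes C: "0 < C\<^sub>1" "9/5 \<le> C\<^sub>2" and y: "0 \<le> y" "y \<le> 5 * sqrt C\<^sub>2 * C\<^sub>1" and N: "0 \<le> N"
  defines "l \<equiv> y / (4 * pi * C\<^sub>1\<^sup>2 * C\<^sub>2)"
  shows "l\<^sup>2 * pi\<^sup>2 * C\<^sub>1\<^sup>2 / 4 \<le> 3/8"
    and "l\<^sup>2 * pi\<^sup>2 * C\<^sub>1\<^sup>2 / 4 * N * (1 + 16/3 * ln 2) - l * (N * y) \<le> - (N * y\<^sup>2 / (32 * C\<^sub>2 * C\<^sub>1\<^sup>2))"
proof -
  define r where "r = y\<^sup>2 / (C\<^sub>1\<^sup>2 * C\<^sub>2)"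
  have c: "l\<^sup>2 * pi\<^sup>2 * C\<^sub>1\<^sup>2 / 4 = r / (64 * C\<^sub>2)"
    using C unfolding l_def r_def by (simp add: field_simps power2_eq_square)
  have r0: "0 \<le> r" using C by (simp add: r_def)
  have "y\<^sup>2 \<le> (5 * sqrt C\<^sub>2 * C\<^sub>1)\<^sup>2" using y by (intro power_mono) auto
  also have "\<dots> = 25 * (C\<^sub>1\<^sup>2 * C\<^sub>2)" using C by (simp add: power_mult_distrib)
  finally have "r \<le> 25" unfolding r_def using C by (simp add: divide_le_eq)
  then show "l\<^sup>2 * pi\<^sup>2 * C\<^sub>1\<^sup>2 / 4 \<le> 3/8"
    unfolding c using C by (simp add: divide_le_eq)
  have "(1 + 16/3 * ln 2) / (64 * C\<^sub>2) \<le> (1 + 16/3 * (25/36)) / (64 * (9/5))"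
    using C ln2_le_25_over_36 by (intro frac_le) auto
  moreover have "5/68 \<le> 1 / (4 * pi)"
    using pi_less_17_5 by (simp add: field_simps)
  moreover have "(1 + 16/3 * (25/36)) / (64 * (9/5)) - 5/68 \<le> - (1/32 :: real)"
    by simp
  ultimately have "(1 + 16/3 * ln 2) / (64 * C\<^sub>2) - 1 / (4 * pi) \<le> - (1/32)"
    by linarith
  moreover define a b where "a = (1 + 16/3 * ln 2) / (64 * C\<^sub>2)" and "b = 1 / (4 * pi)"
  ultimately have "a - b \<le> - (1/32)" by simp
  then have le: "N * r * (a - b) \<le> N * r * - (1/32)"
    using N r0 by (intro mult_left_mono) auto
  have eq1: "r / (64 * C\<^sub>2) * N * (1 + 16/3 * ln 2) = N * r * a"
    by (simp add: a_def)
  have eq2: "l * (N * y) = N * r * b"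
    using C unfolding l_def r_def b_def by (simp add: field_simps power2_eq_square)
  have eq3: "N * y\<^sup>2 / (32 * C\<^sub>2 * C\<^sub>1\<^sup>2) = N * r * (1/32)"
    using C unfolding r_def by (simp add: field_simps)
  show "l\<^sup>2 * pi\<^sup>2 * C\<^sub>1\<^sup>2 / 4 * N * (1 + 16/3 * ln 2) - l * (N * y) \<le> - (N * y\<^sup>2 / (32 * C\<^sub>2 * C\<^sub>1\<^sup>2))"
    unfolding c eq1 eq2 eq3 using le by (simp add: right_diff_distrib)
qed

theorem proposition1p10:
  fixes P :: "'w measure"
    and G :: "nat \<times> nat \<Rightarrow> 'w \<Rightarrow> real"
    and U :: "real \<Rightarrow> real"
    and \<eta> C\<^sub>1 C\<^sub>2 :: real
    and M N :: nat
  assumes C2_ge: "1 \<le> C\<^sub>2"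
    and C2_tail: "\<And>m n t. 0 < n \<Longrightarrow> m \<le> n \<Longrightarrow> 0 \<le> t \<Longrightarrow>
          measure (gaussian_matrix m n)
            {A \<in> space (gaussian_matrix m n). s_max (Matrix.mat m n A) \<ge> sqrt (C\<^sub>2 * real n) + t}
          \<le> 2 * exp (- (t\<^sup>2 / C\<^sub>2))"
    and U_meas: "U \<in> borel_measurable borel"
    and U_range: "\<And>x. U x \<in> {0..1}"
    and U_nondeg: "(LINT \<xi>|std_normal_distribution. \<xi> * U \<xi>) \<noteq> 0"
    and eta_pos: "0 < \<eta>"
    and C1_pos: "0 < C\<^sub>1"
    and C1_bound: "\<And>x. \<bar>deriv (\<lambda>y. ln (smoothed U \<eta> y)) x\<bar> \<le> C\<^sub>1 * (1 + \<bar>x\<bar>)"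
    and dims: "0 < N" "M \<le> N"
    and P: "prob_space P"
    and G_indep: "prob_space.indep_vars P (\<lambda>_. borel) G ({..<M} \<times> {..<N})"
    and G_gauss: "\<And>k. k \<in> {..<M} \<times> {..<N} \<Longrightarrow> distributed P lborel (G k) std_normal_density"
  shows "integrable P (\<lambda>\<omega>. ln (partition_fun U \<eta> M N (\<lambda>k. G k \<omega>))) \<and>
    (\<forall>x. 0 \<le> x \<and> x \<le> 5 * sqrt C\<^sub>2 * C\<^sub>1 \<longrightarrow>
      measure P {\<omega> \<in> space P.
          \<bar>ln (partition_fun U \<eta> M N (\<lambda>k. G k \<omega>))
            - (LINT \<omega>'|P. ln (partition_fun U \<eta> M N (\<lambda>k. G k \<omega>')))\<bar> \<ge> real N * x}
      \<le> 32 * real N * exp (- (real N * x\<^sup>2 / (32 * C\<^sub>2 * C\<^sub>1\<^sup>2))))"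
proof -
  interpret prob_space P by (rule P)
  have C2: "9/5 \<le> C\<^sub>2"
    using C2_tail[of 1 1] by (intro edge_constant_lower C2_ge) simp
  obtain V' where V': "\<And>x. (smoothed U \<eta> has_real_derivative V' x) (at x)" and V'_cont: "\<And>x. isCont V' x"
    using smoothed_C1[OF U_meas U_range eta_pos] by blast
  note V_pos = smoothed_pos[OF U_meas U_range eta_pos U_nondeg]
  define L where "L x = ln (smoothed U \<eta> x)" for x
  define u where "u x = V' x / smoothed U \<eta> x" for x
  have L_deriv: "(L has_real_derivative u x) (at x)" for x
    unfolding L_def u_def using DERIV_chain2[OF DERIV_ln[OF V_pos] V', of x] by (simp add: divide_inverse mult.commute)
  interpret perceptron L u C\<^sub>1 M N
  proof
    show "isCont u x" for x
      unfolding u_def using V_pos[of x] by (intro continuous_intros V'_cont DERIV_isCont[OF V']) simp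
    show "\<bar>u x\<bar> \<le> C\<^sub>1 * (1 + \<bar>x\<bar>)" for x
      using C1_bound[of x] DERIV_imp_deriv[OF L_deriv[unfolded L_def]] by simp
    show "L x \<le> 0" for x
      unfolding L_def using V_pos smoothed_le_1[OF U_meas U_range] by simp
  qed (use dims C1_pos L_deriv in auto)
  define X where "X \<omega> = (\<lambda>k\<in>idx. G k \<omega>)" for \<omega>
  have weight_eq: "weight x J = (\<Prod>a<M. smoothed U \<eta> (\<Delta> x J a))" for x J
    unfolding weight_def L_def using V_pos by (simp add: exp_sum)
  have F_eq: "ln (partition_fun U \<eta> M N (\<lambda>k. G k \<omega>)) = logZ (X \<omega>)" for \<omega>
    unfolding X_def logZ_restrict unfolding logZ_def Z_def weight_eq spins_def \<Delta>_def partition_fun_def ..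
  have X_meas [measurable]: "X \<in> P \<rightarrow>\<^sub>M \<mu>"
    unfolding X_def \<mu>_def
  proof (rule measurable_restrict)
    fix k assume "k \<in> idx"
    then have "G k \<in> P \<rightarrow>\<^sub>M lborel" using G_gauss by (intro distributed_measurable) (auto simp: idx_def)
    then show "G k \<in> P \<rightarrow>\<^sub>M gauss" by (simp cong: measurable_cong_sets)
  qed
  have law: "distr P \<mu> X = \<mu>"
    unfolding X_def \<mu>_def using G_gauss G_indep
    by (intro distr_gauss_vec[OF P finite_idx]) (auto simp: idx_def)
  define mean where "mean = (LINT \<omega>|P. logZ (X \<omega>))"
  have mean: "mean = integral\<^sup>L \<mu> logZ"
    unfolding mean_def by (subst integral_distr[symmetric, OF X_meas logZ_measurable]) (simp add: law)
  have int: "integrable P (\<lambda>\<omega>. logZ (X \<omega>))"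
    by (subst integrable_distr_eq[symmetric, OF X_meas logZ_measurable]) (simp add: law logZ_integrable)
  have tail: "prob {\<omega> \<in> space P. s \<le> l * (logZ (X \<omega>) - mean)}
      \<le> exp (l\<^sup>2 * pi\<^sup>2 * C\<^sub>1\<^sup>2 / 4 * N * (1 + 16/3 * ln 2)) * exp (- s)"
    if "l\<^sup>2 * pi\<^sup>2 * C\<^sub>1\<^sup>2 / 4 \<le> 3/8" for l s
  proof (rule exponential_Markov)
    have "(\<integral>\<^sup>+\<omega>. ennreal (exp (l * (logZ (X \<omega>) - mean))) \<partial>P)
        = (\<integral>\<^sup>+x. ennreal (exp (l * (logZ x - integral\<^sup>L \<mu> logZ))) \<partial>distr P \<mu> X)"
      unfolding mean by (rule nn_integral_distr[symmetric]) measurable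
    then show "(\<integral>\<^sup>+\<omega>. ennreal (exp (l * (logZ (X \<omega>) - mean))) \<partial>P)
        \<le> ennreal (exp (l\<^sup>2 * pi\<^sup>2 * C\<^sub>1\<^sup>2 / 4 * N * (1 + 16/3 * ln 2)))"
      using logZ_mgf[OF dims(2) that] by (simp add: law)
  qed auto
  have "prob {\<omega> \<in> space P. real N * x \<le> \<bar>logZ (X \<omega>) - mean\<bar>}
      \<le> 32 * real N * exp (- (real N * x\<^sup>2 / (32 * C\<^sub>2 * C\<^sub>1\<^sup>2)))"
    if x: "0 \<le> x" "x \<le> 5 * sqrt C\<^sub>2 * C\<^sub>1" for x
  proof -
    define l where "l = x / (4 * pi * C\<^sub>1\<^sup>2 * C\<^sub>2)"
    define E where "E = exp (- (real N * x\<^sup>2 / (32 * C\<^sub>2 * C\<^sub>1\<^sup>2)))"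
    note opt = optimised_exponent[OF C1_pos C2 x, of N, folded l_def]
    have l0: "0 \<le> l" using x C2_ge by (simp add: l_def)
    \<comment> \<open>Covers both tails: it is applied with \<open>k = l\<close> and with \<open>k = - l\<close>.\<close>
    have one: "prob {\<omega> \<in> space P. l * (N * x) \<le> k * (logZ (X \<omega>) - mean)} \<le> E" if "k\<^sup>2 = l\<^sup>2" for k
    proof -
      have "prob {\<omega> \<in> space P. l * (N * x) \<le> k * (logZ (X \<omega>) - mean)}
          \<le> exp (l\<^sup>2 * pi\<^sup>2 * C\<^sub>1\<^sup>2 / 4 * N * (1 + 16/3 * ln 2)) * exp (- (l * (N * x)))"
        using tail[of k "l * (N * x)"] opt(1) that by simp
      also have "\<dots> \<le> E"
        unfolding E_def exp_add[symmetric] using opt(2) by simp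
      finally show ?thesis .
    qed
    have "prob {\<omega> \<in> space P. real N * x \<le> \<bar>logZ (X \<omega>) - mean\<bar>}
        \<le> prob ({\<omega> \<in> space P. l * (N * x) \<le> l * (logZ (X \<omega>) - mean)}
               \<union> {\<omega> \<in> space P. l * (N * x) \<le> - l * (logZ (X \<omega>) - mean)})"
    proof (rule finite_measure_mono)
      show "{\<omega> \<in> space P. real N * x \<le> \<bar>logZ (X \<omega>) - mean\<bar>}
          \<subseteq> {\<omega> \<in> space P. l * (N * x) \<le> l * (logZ (X \<omega>) - mean)}
            \<union> {\<omega> \<in> space P. l * (N * x) \<le> - l * (logZ (X \<omega>) - mean)}"
      proof safe
        fix \<omega> assume a: "real N * x \<le> \<bar>logZ (X \<omega>) - mean\<bar>"
          and b: "\<not> l * (N * x) \<le> - l * (logZ (X \<omega>) - mean)"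
        have "l * (N * x) \<le> l * \<bar>logZ (X \<omega>) - mean\<bar>" using a l0 by (rule mult_left_mono)
        with b show "l * (N * x) \<le> l * (logZ (X \<omega>) - mean)" by (auto simp: abs_if split: if_splits)
      qed
    qed measurable
    also have "\<dots> \<le> prob {\<omega> \<in> space P. l * (N * x) \<le> l * (logZ (X \<omega>) - mean)}
        + prob {\<omega> \<in> space P. l * (N * x) \<le> - l * (logZ (X \<omega>) - mean)}"
      by (rule measure_Un_le) measurable
    also have "\<dots> \<le> E + E" by (intro add_mono one) simp_all
    also have "\<dots> \<le> 32 * real N * E"
    proof -
      have "2 * E \<le> (32 * real N) * E" using dims by (intro mult_right_mono) (auto simp: E_def)
      then show ?thesis by simp
    qed
    finally show ?thesis by (simp add: E_def)
  qed
  with int show ?thesis unfolding F_eq mean_def by blast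
qed

end
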